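(* Let $N\ge 2$ be an integer, $h=1/N$, $m=N-1$, $\varepsilon>0$ with $\varepsilon\ll h$, and $\delta=\varepsilon/h$. Let $A$ be the $m^2\times m^2$ uniform-mesh five-point finite difference matrix with off-diagonal stencil entries $-\varepsilon^2$ and diagonal entries $4\varepsilon^2+h^2b(x_i,y_j)=\mathcal{O}(h^2)$ (see the context), and let $L$ be its Cholesky factor, $A=LL^T$, in exact arithmetic. Then the entries of $L$, and in particular its fill-in entries, are as follows. (i) (Block structure.) Partition $L$ into $m\times m$ blocks, each of size $m\times m$. Then $$L=\begin{pmatrix} M&&&&\\ P&Q&&&\\ &P&Q&&\\ &&\ddots&\ddots&\\ &&&P&Q\end{pmatrix},$$ where all blocks not shown are zero, and $M$, $P$, $Q$ denote patterns of magnitudes (different blocks with the same letter have the same pattern, not necessarily the same entries): - $M$ is lower bidiagonal, with diagonal entries $\mathcal{O}(h)$ and first-subdiagonal entries $\mathcal{O}(\varepsilon^2/h)$. - $P$ is upper triangular, with diagonal entries $\mathcal{O}(\varepsilon^2/h)$; for $1\le x<y\le m$ its $(x,y)$ entry belongs to $L^{[y-x]}$. - $Q$ is lower triangular, with diagonal entries $\mathcal{O}(h)$ and first-subdiagonal entries $\mathcal{O}(\varepsilon^2/h)$; for $1\le y<x\le m$ with $x-y\ge 2$ its $(x,y)$ entry belongs to $L^{[x-y+1]}$. (ii) (Magnitudes.) The magnitude $l^{[k]}$ of the entries belonging to $L^{[k]}$ is $$l^{[k]}=\mathcal{O}\!\left(\varepsilon^{2(k+1)}/h^{2k+1}\right)=\mathcal{O}\!\left(\delta^{2(k+1)}h\right)\qquad\text{for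 } k=1,2,\dots,m.$$
   Context: **The matrix $A$.** It arises from the symmetrised five-point finite difference discretisation of $-\varepsilon^2\Delta u+b(x,y)u=f(x,y)$ on $(0,1)^2$, with Dirichlet boundary data and $b(x,y)\ge\beta^2>0$, on the uniform mesh $x_i=ih$, $y_j=jh$, $h=1/N$. The unknowns are at the $m^2$ interior points, $1\le i,j\le m=N-1$, in natural (lexicographic) order: point $(x_i,y_j)$ has index $(j-1)m+i$. The diagonal entry of $A$ at the index of $(x_i,y_j)$ is $4\varepsilon^2+h^2b(x_i,y_j)$, which is taken to be $\mathcal{O}(h^2)$ since $\varepsilon\ll h$. The entry coupling two interior points that are nearest horizontal or vertical neighbours in the grid is $-\varepsilon^2$. All other entries are $0$. Thus $A=[a(i,j)]$ is symmetric positive definite with bandwidth $m$. **Cholesky factor.** $L=[l(i,j)]$ is the unique lower triangular matrix with positive diagonal such that $A=LL^T$. The fill-in is the set of nonzero entries of $L$ at positions where $A$ has a zero. **Meaning of $\mathcal{O}$.** $f=\mathcal{O}(g)$ means that there are positive constants $C_0,C_1$, independent of $N$ and $\varepsilon$, such that $C_0|g|\le|f|\le C_1|g|$. **The sets $L^{[k]}$.** The entries of $L$ are divided into distinct sets, with all entries of the same magnitude in the same set: $l^{[k]}$ denotes the magnitude of the entries in $L^{[k]}$, that is, $l(i,j)\in L^{[k]}$ if and only if $l(i,j)$ is $\mathcal{O}(l^{[k]})$. These sets are distinct in the sense that $l^{[k]}\gg l^{[k+1]}$ for $k\ge1$. By convention, $L^{[0]}$ is the set of entries at the positions of nonzero entries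 of $A$, and entries of $L$ that are zero in exact arithmetic belong to $L^{[\infty]}$. Membership is tracked through the column-by-column computation of $L$: $l(i,j)\in L^{[p_{i,j}]}$, where every $p_{i,j}$ is initially $\infty$ and is updated by $$p_{i,j}=\begin{cases}\min\{0,\;p_{i,1}+p_{j,1}+1,\;\dots,\;p_{i,j-1}+p_{j,j-1}+1\}&\text{if }a(i,j)\ne0,\\ \min\{p_{i,1}+p_{j,1}+1,\;\dots,\;p_{i,j-1}+p_{j,j-1}+1\}&\text{otherwise.}\end{cases}$$ *)

theory Defs
  imports
    "Jordan_Normal_Form.Matrix"
    "HOL-Library.Extended_Nat"
    "HOL-Library.Landau_Symbols"
begin

definition mesh :: "nat \<Rightarrow> real" where
  "mesh N = 1 / real N"

text \<open>
  Matrices are indexed from 0. With m = N - 1, the grid point (x_i, y_j), where i and j run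
  from 1 to m, has index r = (j-1) m + (i-1), so that i - 1 = r mod m and j - 1 = r div m.
\<close>

definition neighbours :: "nat \<Rightarrow> nat \<Rightarrow> nat \<Rightarrow> bool" where
  "neighbours m r s \<longleftrightarrow>
     (r div m = s div m \<and> (r mod m = Suc (s mod m) \<or> s mod m = Suc (r mod m))) \<or>
     (r mod m = s mod m \<and> (r div m = Suc (s div m) \<or> s div m = Suc (r div m)))"

definition fd_matrix :: "(real \<Rightarrow> real \<Rightarrow> real) \<Rightarrow> nat \<Rightarrow> real \<Rightarrow> real mat" where
  "fd_matrix b N \<epsilon> = mat ((N - 1)^2) ((N - 1)^2) (\<lambda>(r, s).
     if r = s then
       4 * \<epsilon>^2 + (mesh N)^2 *
         b (real (r mod (N - 1) + 1) * mesh N) (real (r div (N - 1) + 1) * mesh N)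
     else if neighbours (N - 1) r s then - (\<epsilon>^2)
     else 0)"

definition cholesky_factor :: "real mat \<Rightarrow> real mat \<Rightarrow> bool" where
  "cholesky_factor A L \<longleftrightarrow>
     L \<in> carrier_mat (dim_row A) (dim_row A) \<and>
     (\<forall>i < dim_row A. \<forall>j < dim_row A. i < j \<longrightarrow> L $$ (i, j) = 0) \<and>
     (\<forall>i < dim_row A. 0 < L $$ (i, i)) \<and>
     A = L * transpose_mat L"

definition fill_in :: "real mat \<Rightarrow> real mat \<Rightarrow> (nat \<times> nat) set" where
  "fill_in A L = {(i, j). i < dim_row A \<and> j < dim_row A \<and> A $$ (i, j) = 0 \<and> L $$ (i, j) \<noteq> 0}"

text \<open>
  The numbers p(i,j). They are meaningful for j at most i. The infimum over the empty
  set of columns is \<open>\<infinity>\<close>, the initial value.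
\<close>

function level :: "real mat \<Rightarrow> nat \<Rightarrow> nat \<Rightarrow> enat" where
  "level A i j =
     (if A $$ (i, j) \<noteq> 0
      then min 0 (INF c \<in> {..<j}. level A i c + level A j c + 1)
      else (INF c \<in> {..<j}. level A i c + level A j c + 1))"
  by pat_completeness auto
termination by (relation "measure (\<lambda>(A, i, j). j)") auto

declare level.simps [simp del]

text \<open>
  The set of positions whose entry belongs to the k-th magnitude class; entries with
  k = \<open>\<infinity>\<close> are the ones that are zero in exact arithmetic.
\<close>

definition level_set :: "real mat \<Rightarrow> enat \<Rightarrow> (nat \<times> nat) set" where
  "level_set A k = {(i, j). j \<le> i \<and> i < dim_row A \<and> level A i j = k}"

lemma level_eq_0_iff: "level A i j = 0 \<longleftrightarrow> A $$ (i, j) \<noteq> 0"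
proof -
  have "1 \<le> (INF c \<in> {..<j}. level A i c + level A j c + 1)"
    by (rule INF_greatest) simp
  then have "(INF c \<in> {..<j}. level A i c + level A j c + 1) \<noteq> 0"
    by (metis not_one_le_zero)
  then show ?thesis
    by (subst level.simps) (simp add: min_def)
qed

text \<open>
  The order relation is two-sided. The constants may not depend on the index \<open>s\<close>, which will
  comprise N, \<open>\<epsilon>\<close> and the position of the matrix entry.
\<close>

definition same_order :: "'s set \<Rightarrow> ('s \<Rightarrow> real) \<Rightarrow> ('s \<Rightarrow> real) \<Rightarrow> bool" where
  "same_order S f g \<longleftrightarrow>
     (\<exists>C0 > 0. \<exists>C1 > 0. \<forall>s \<in> S. C0 * \<bar>g s\<bar> \<le> \<bar>f s\<bar> \<and> \<bar>f s\<bar> \<le> C1 * \<bar>g s\<bar>)"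

lemma same_order_iff_bigtheta: "same_order S f g \<longleftrightarrow> f \<in> \<Theta>[principal S](g)"
proof
  assume "same_order S f g"
  then obtain C0 C1 where C: "C0 > 0" "C1 > 0"
    "\<forall>s \<in> S. C0 * \<bar>g s\<bar> \<le> \<bar>f s\<bar> \<and> \<bar>f s\<bar> \<le> C1 * \<bar>g s\<bar>"
    unfolding same_order_def by blast
  show "f \<in> \<Theta>[principal S](g)"
  proof (rule bigthetaI)
    show "f \<in> O[principal S](g)"
      using C by (intro landau_o.bigI[of C1]) (auto simp: eventually_principal)
    show "f \<in> \<Omega>[principal S](g)"
      using C by (intro landau_omega.bigI[of C0]) (auto simp: eventually_principal)
  qed
next
  assume f: "f \<in> \<Theta>[principal S](g)"
  obtain C1 where C1: "C1 > 0" "\<forall>s \<in> S. \<bar>f s\<bar> \<le> C1 * \<bar>g s\<bar>"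
    using bigthetaD1[OF f] by (auto elim!: landau_o.bigE simp: eventually_principal)
  obtain C0 where C0: "C0 > 0" "\<forall>s \<in> S. C0 * \<bar>g s\<bar> \<le> \<bar>f s\<bar>"
    using bigthetaD2[OF f] by (auto elim!: landau_omega.bigE simp: eventually_principal)
  show "same_order S f g"
    unfolding same_order_def using C0 C1 by blast
qed

text \<open>
  The parameters with \<open>\<epsilon>\<close> much smaller than h, made precise as \<open>\<epsilon> \<le> \<delta>0 h\<close> for a
  threshold \<open>\<delta>0\<close> that does not depend on N or \<open>\<epsilon>\<close>.
\<close>

definition regime :: "real \<Rightarrow> (nat \<times> real) set" where
  "regime \<delta>0 = {(N, \<epsilon>). 2 \<le> N \<and> 0 < \<epsilon> \<and> \<epsilon> \<le> \<delta>0 * mesh N}"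

text \<open>
  Position in the full matrix of the entry (x, y) of the m by m block in block row I and
  block column J; all four are counted from 0.
\<close>

definition block_pos :: "nat \<Rightarrow> nat \<Rightarrow> nat \<Rightarrow> nat \<Rightarrow> nat \<Rightarrow> nat \<times> nat" where
  "block_pos m I J x y = (I * m + x, J * m + y)"

end

theory Submission
  imports Defs
begin

text \<open>
  The matrix A has nonpositive off-diagonal entries, and this excludes cancellation: in the
  recursion l(i,j) l(j,j) = a(i,j) - (sum of l(i,c) l(j,c) over c < j), for j < i, all off-diagonal
  entries of L are nonpositive by induction, so that every product l(i,c) l(j,c) enlarges the
  modulus of l(i,j) (\<open>abs_L_recursion\<close>). An entry with j \<le> i therefore vanishes exactly if its
  level is infinite, and an off-diagonal entry of finite level k is at least \<epsilon>^(2(k+1)) / H^(2k+1) in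
  modulus if the diagonal entries of L are at most H: for k \<ge> 1 it dominates one product of entries
  of levels p and q with p + q + 1 = k, divided by H (\<open>abs_L_ge_if_level_finite\<close>).

  The levels depend on the zero pattern of A only. For the five-point pattern they have a closed
  form, \<open>grid_level\<close>, which is verified column by column (\<open>grid_level_recursion\<close>). It contains the
  block structure, the zeros and the classes of the fill-in entries.

  Upper bounds that are uniform in N need more than the recursion, because an entry collects
  contributions from a number of columns that grows with N. They come from the inverse positivity
  of L: if v and A v are nonnegative, then so is L^T v = L^(-1) A v, which gives
  |l(i,j)| v(i) \<le> l(j,j) v(j) (\<open>abs_L_le_weight_ratio\<close>). With v = 1, the same argument gives
  l(i,i) \<ge> \<beta> h (\<open>L_diag_ge\<close>), while l(i,i)^2 \<le> a(i,i) always holds. With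
  v(i) = \<tau>^(-dist(i,j)) for the grid distance and \<tau> = 4 \<epsilon>^2 / (\<beta> h)^2, it gives
  |l(i,j)| \<le> l(j,j) \<tau>^dist(i,j) (\<open>abs_L_le_decay\<close>).

  For the first subdiagonals of the diagonal blocks and for the blocks P, the distance is the level
  plus 1, so this decay already has the right order \<tau>^(k+1) h. A fill-in entry of Q at distance e
  has level e + 1, and the decay gives only \<tau>^e instead of \<tau>^(e+2). One application of the
  recursion recovers the factor \<tau>^2: a column that contributes belongs to a point in the same grid
  line to the left of both points, or to a point in the preceding grid line that is not to the left
  of either. The distances to the two points then add up to at least e + 2, and the contributions
  sum like a geometric series (\<open>sum_fill_le\<close>).
\<close>

section \<open>Cholesky factors of matrices with nonpositive off-diagonal entries\<close>

lemma level_eq_INF: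
  "A $$ (i, j) = 0 \<Longrightarrow> level A i j = (INF c \<in> {..<j}. level A i c + level A j c + 1)"
  by (subst level.simps) (simp only: simp_thms if_False)

text \<open>
  A symmetric positive definite matrix with nonpositive off-diagonal entries is called a Stieltjes
  matrix; symmetry and definiteness are implied by the existence of the factor.
\<close>

locale stieltjes_cholesky =
  fixes n :: nat and A L :: "real mat"
  assumes A_carrier: "A \<in> carrier_mat n n"
    and factor: "cholesky_factor A L"
    and offdiag_nonpos: "\<And>i j. i < n \<Longrightarrow> j < n \<Longrightarrow> i \<noteq> j \<Longrightarrow> A $$ (i, j) \<le> 0"
begin

lemma L_carrier: "L \<in> carrier_mat n n"
  using factor A_carrier unfolding cholesky_factor_def by auto

lemma L_upper_zero: "i < n \<Longrightarrow> j < n \<Longrightarrow> i < j \<Longrightarrow> L $$ (i, j) = 0"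
  using factor A_carrier unfolding cholesky_factor_def by auto

lemma L_diag_pos: "i < n \<Longrightarrow> 0 < L $$ (i, i)"
  using factor A_carrier unfolding cholesky_factor_def by auto

lemma A_entry: "i < n \<Longrightarrow> j < n \<Longrightarrow> A $$ (i, j) = (\<Sum>c<n. L $$ (i, c) * L $$ (j, c))"
proof -
  assume ij: "i < n" "j < n"
  have "A = L * transpose_mat L"
    using factor unfolding cholesky_factor_def by simp
  then have "A $$ (i, j) = (L * transpose_mat L) $$ (i, j)"
    by simp
  also have "\<dots> = (\<Sum>c<n. L $$ (i, c) * L $$ (j, c))"
    using ij L_carrier by (simp add: scalar_prod_def atLeast0LessThan)
  finally show ?thesis .
qed

lemma A_entry_lower:
  assumes "j \<le> i" "i < n"
  shows "A $$ (i, j) = (\<Sum>c<j. L $$ (i, c) * L $$ (j, c)) + L $$ (i, j) * L $$ (j, j)"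
proof -
  have "(\<Sum>c<n. L $$ (i, c) * L $$ (j, c)) = (\<Sum>c<Suc j. L $$ (i, c) * L $$ (j, c))"
    using assms L_upper_zero by (intro sum.mono_neutral_right) auto
  then show ?thesis
    using A_entry[of i j] assms by simp
qed

lemma A_diag: "i < n \<Longrightarrow> A $$ (i, i) = (\<Sum>c<i. (L $$ (i, c))\<^sup>2) + (L $$ (i, i))\<^sup>2"
  using A_entry_lower[of i i] by (simp add: power2_eq_square)

lemma L_diag_sq_le: "i < n \<Longrightarrow> (L $$ (i, i))\<^sup>2 \<le> A $$ (i, i)"
  using A_diag[of i] by (simp add: sum_nonneg)

text \<open>
  The products in the recursion are nonnegative by induction and are subtracted from an entry of A
  that is itself nonpositive.
\<close>

lemma L_offdiag_nonpos: "j < i \<Longrightarrow> i < n \<Longrightarrow> L $$ (i, j) \<le> 0"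
proof (induction j arbitrary: i rule: less_induct)
  case (less j)
  have "0 \<le> (\<Sum>c<j. L $$ (i, c) * L $$ (j, c))"
    using less by (intro sum_nonneg mult_nonpos_nonpos) auto
  moreover have "A $$ (i, j) \<le> 0"
    using less.prems by (intro offdiag_nonpos) auto
  ultimately have "L $$ (i, j) * L $$ (j, j) \<le> 0"
    using A_entry_lower[of j i] less.prems by simp
  moreover have "0 < L $$ (j, j)"
    using L_diag_pos less.prems by simp
  ultimately show ?case
    by (simp add: mult_le_0_iff)
qed

text \<open>
  All terms of the recursion have the same sign, so it holds for the moduli without any
  cancellation. Lower bounds follow from single terms of the sum.
\<close>

lemma abs_L_recursion:
  assumes "j < i" "i < n"
  shows "\<bar>L $$ (i, j)\<bar> * L $$ (j, j) =
    \<bar>A $$ (i, j)\<bar> + (\<Sum>c<j. \<bar>L $$ (i, c)\<bar> * \<bar>L $$ (j, c)\<bar>)"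
proof -
  have "(\<Sum>c<j. \<bar>L $$ (i, c)\<bar> * \<bar>L $$ (j, c)\<bar>) = (\<Sum>c<j. L $$ (i, c) * L $$ (j, c))"
    using assms L_offdiag_nonpos by (intro sum.cong) (auto simp: abs_of_nonpos)
  moreover have "\<bar>A $$ (i, j)\<bar> = - A $$ (i, j)" "\<bar>L $$ (i, j)\<bar> = - L $$ (i, j)"
    using offdiag_nonpos[of i j] L_offdiag_nonpos[of j i] assms by (auto simp: abs_of_nonpos)
  ultimately show ?thesis
    using A_entry_lower[of j i] assms by simp
qed

text \<open>
  The inverse positivity of L. With w = L^T v, the equation L w = A v is solved forwards: the
  off-diagonal entries of L are nonpositive, so nonnegative earlier components of w only increase
  the next one.
\<close>

lemma weighted_row_sum_le:
  assumes Av: "\<And>i. i < n \<Longrightarrow> 0 \<le> (\<Sum>s<n. A $$ (i, s) * v s)"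
    and "i < n"
  shows "(\<Sum>s<n. A $$ (i, s) * v s) \<le> L $$ (i, i) * (\<Sum>r<n. L $$ (r, i) * v r)"
  using \<open>i < n\<close>
proof (induction i rule: less_induct)
  case (less i)
  define w where "w c = (\<Sum>r<n. L $$ (r, c) * v r)" for c
  have "(\<Sum>s<n. A $$ (i, s) * v s) = (\<Sum>s<n. \<Sum>c<n. L $$ (i, c) * (L $$ (s, c) * v s))"
    using less.prems by (intro sum.cong) (auto simp: A_entry sum_distrib_right mult.assoc)
  also have "\<dots> = (\<Sum>c<n. L $$ (i, c) * w c)"
    unfolding w_def sum_distrib_left by (rule sum.swap)
  also have "\<dots> = (\<Sum>c<Suc i. L $$ (i, c) * w c)"
    using less.prems L_upper_zero by (intro sum.mono_neutral_right) auto
  finally have split: "(\<Sum>s<n. A $$ (i, s) * v s) = (\<Sum>c<i. L $$ (i, c) * w c) + L $$ (i, i) * w i"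
    by simp
  have "0 \<le> w c" if "c < i" for c
  proof -
    have "0 \<le> L $$ (c, c) * w c"
      using less.IH[of c] Av[of c] that less.prems unfolding w_def by force
    then show ?thesis
      using L_diag_pos[of c] that less.prems by (simp add: zero_le_mult_iff)
  qed
  then have "(\<Sum>c<i. L $$ (i, c) * w c) \<le> 0"
    using less.prems L_offdiag_nonpos by (intro sum_nonpos mult_nonpos_nonneg) auto
  then show ?case
    using split unfolding w_def by simp
qed

lemma weighted_column_sum:
  assumes "j < n"
  shows "(\<Sum>r<n. L $$ (r, j) * v r) =
    L $$ (j, j) * v j - (\<Sum>r\<in>{j<..<n}. \<bar>L $$ (r, j)\<bar> * v r)"
proof -
  have "(\<Sum>r<n. L $$ (r, j) * v r) = (\<Sum>r\<in>insert j {j<..<n}. L $$ (r, j) * v r)"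
    using assms L_upper_zero by (intro sum.mono_neutral_right) auto
  also have "\<dots> = L $$ (j, j) * v j + (\<Sum>r\<in>{j<..<n}. L $$ (r, j) * v r)"
    by simp
  also have "(\<Sum>r\<in>{j<..<n}. L $$ (r, j) * v r) = - (\<Sum>r\<in>{j<..<n}. \<bar>L $$ (r, j)\<bar> * v r)"
    unfolding sum_negf[symmetric]
    using assms L_offdiag_nonpos by (intro sum.cong) (auto simp: abs_of_nonpos)
  finally show ?thesis by simp
qed

text \<open>
  The weight v = 1: the column sum of L is at most its diagonal entry, since the other entries are
  nonpositive.
\<close>

lemma L_diag_sq_ge:
  assumes "\<And>i. i < n \<Longrightarrow> 0 \<le> (\<Sum>s<n. A $$ (i, s))" "i < n"
  shows "(\<Sum>s<n. A $$ (i, s)) \<le> (L $$ (i, i))\<^sup>2"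
proof -
  have "(\<Sum>s<n. A $$ (i, s)) \<le> L $$ (i, i) * (\<Sum>r<n. L $$ (r, i))"
    using weighted_row_sum_le[of "\<lambda>_. 1" i] assms by simp
  also have "\<dots> \<le> L $$ (i, i) * L $$ (i, i)"
    using weighted_column_sum[of i "\<lambda>_. 1"] L_diag_pos[of i] assms
    by (intro mult_left_mono) (auto intro!: sum_nonneg)
  finally show ?thesis
    by (simp add: power2_eq_square)
qed

text \<open>
  Nonnegativity of L^T v in component j bounds the weighted sum of all subdiagonal entries in
  column j by the diagonal term, hence also each single one. A weight that grows fast away from j
  turns this into a decay estimate.
\<close>

lemma abs_L_le_weight_ratio:
  assumes Av: "\<And>i. i < n \<Longrightarrow> 0 \<le> (\<Sum>s<n. A $$ (i, s) * v s)"
    and v: "\<And>i. i < n \<Longrightarrow> 0 \<le> v i"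
    and ij: "j \<le> i" "i < n"
  shows "\<bar>L $$ (i, j)\<bar> * v i \<le> L $$ (j, j) * v j"
proof (cases "i = j")
  case True
  then show ?thesis using L_diag_pos[of j] ij by simp
next
  case False
  have "0 \<le> L $$ (j, j) * (\<Sum>r<n. L $$ (r, j) * v r)"
    using weighted_row_sum_le[OF Av, of j] Av[of j] ij by force
  then have "0 \<le> (\<Sum>r<n. L $$ (r, j) * v r)"
    using L_diag_pos[of j] ij by (simp add: zero_le_mult_iff)
  moreover have "\<bar>L $$ (i, j)\<bar> * v i \<le> (\<Sum>r\<in>{j<..<n}. \<bar>L $$ (r, j)\<bar> * v r)"
    using False ij v by (intro member_le_sum) auto
  ultimately show ?thesis
    using weighted_column_sum[of j v] ij by simp
qed

lemma L_eq_0_if_level_infinite: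
  "j < i \<Longrightarrow> i < n \<Longrightarrow> level A i j = \<infinity> \<Longrightarrow> L $$ (i, j) = 0"
proof (induction j arbitrary: i rule: less_induct)
  case (less j)
  have a: "A $$ (i, j) = 0"
    using less.prems level_eq_0_iff[of A i j] by auto
  have "L $$ (i, c) * L $$ (j, c) = 0" if "c < j" for c
  proof -
    have "(INF c \<in> {..<j}. level A i c + level A j c + 1) = \<infinity>"
      using level_eq_INF[of A i j, OF a] less.prems(3) by metis
    moreover have "(INF c \<in> {..<j}. level A i c + level A j c + 1) \<le> level A i c + level A j c + 1"
      using that by (intro INF_lower) simp
    ultimately have "level A i c + level A j c + 1 = \<infinity>"
      by (metis enat_ord_simps(5))
    then have "level A i c = \<infinity> \<or> level A j c = \<infinity>"
      by (cases "level A i c"; cases "level A j c") (simp_all add: one_enat_def)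
    then show ?thesis
      using less.IH[OF that, of i] less.IH[OF that, of j] less.prems that by auto
  qed
  then have "(\<Sum>c<j. L $$ (i, c) * L $$ (j, c)) = 0"
    by (intro sum.neutral) auto
  then have "L $$ (i, j) * L $$ (j, j) = 0"
    using A_entry_lower[of j i] less.prems a by simp
  then show ?case
    using L_diag_pos[of j] less.prems by auto
qed

text \<open>
  The exponents match because the bound is multiplicative along the level recursion: for
  k = p + q + 1, the product of the bounds of levels p and q, divided by H, is the bound of level k.
\<close>

lemma abs_L_ge_if_level_finite:
  assumes a: "0 \<le> a" "\<And>i j. i < n \<Longrightarrow> j < n \<Longrightarrow> i \<noteq> j \<Longrightarrow> A $$ (i, j) \<noteq> 0 \<Longrightarrow> a \<le> \<bar>A $$ (i, j)\<bar>"
    and H: "\<And>i. i < n \<Longrightarrow> L $$ (i, i) \<le> H"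
  shows "j < i \<Longrightarrow> i < n \<Longrightarrow> level A i j = enat k \<Longrightarrow> a ^ (k + 1) / H ^ (2 * k + 1) \<le> \<bar>L $$ (i, j)\<bar>"
proof (induction j arbitrary: i k rule: less_induct)
  case (less j)
  have Hpos: "0 < H"
    using H[of i] L_diag_pos[of i] less.prems by simp
  have ljj: "0 < L $$ (j, j)" "L $$ (j, j) \<le> H"
    using L_diag_pos[of j] H[of j] less.prems by auto
  have "a ^ (k + 1) / H ^ (2 * k) \<le> \<bar>L $$ (i, j)\<bar> * L $$ (j, j)"
  proof (cases "A $$ (i, j) = 0")
    case False
    then have "k = 0"
      using less.prems level_eq_0_iff[of A i j] by (simp add: zero_enat_def)
    then have "a ^ (k + 1) / H ^ (2 * k) \<le> \<bar>A $$ (i, j)\<bar>"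
      using a(2)[of i j] False less.prems by simp
    also have "\<dots> \<le> \<bar>L $$ (i, j)\<bar> * L $$ (j, j)"
      using abs_L_recursion[of j i] less.prems by (simp add: sum_nonneg)
    finally show ?thesis .
  next
    case True
    then have inf: "(INF c \<in> {..<j}. level A i c + level A j c + 1) = enat k"
      using level_eq_INF[of A i j, OF True] less.prems(3) by metis
    have "(INF c \<in> {..<j}. level A i c + level A j c + 1) < enat (Suc k)"
      unfolding inf by simp
    then have "\<exists>c\<in>{..<j}. level A i c + level A j c + 1 < enat (Suc k)"
      by (rule INF_less_iff[THEN iffD1])
    then obtain c where c: "c < j" "level A i c + level A j c + 1 < enat (Suc k)"
      by (metis lessThan_iff)
    moreover have "enat k \<le> level A i c + level A j c + 1"
      unfolding inf[symmetric] using c(1) by (intro INF_lower) simp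
    moreover obtain p q where pq: "level A i c = enat p" "level A j c = enat q"
      using c(2) by (cases "level A i c"; cases "level A j c") (simp_all add: one_enat_def)
    ultimately have k: "k = p + q + 1"
      using c(2) by (simp add: one_enat_def)
    have exp: "a ^ (k + 1) / H ^ (2 * k) =
        (a ^ (p + 1) / H ^ (2 * p + 1)) * (a ^ (q + 1) / H ^ (2 * q + 1))"
      unfolding k by (simp add: power_add mult_ac mult_2_right)
    also have "\<dots> \<le> \<bar>L $$ (i, c)\<bar> * \<bar>L $$ (j, c)\<bar>"
      using less.IH[OF c(1) _ _ pq(1)] less.IH[OF c(1) _ _ pq(2)] less.prems c(1) a(1) Hpos
      by (intro mult_mono) auto
    also have "\<dots> \<le> (\<Sum>c<j. \<bar>L $$ (i, c)\<bar> * \<bar>L $$ (j, c)\<bar>)"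
      using c(1) by (intro member_le_sum[where f = "\<lambda>c. \<bar>L $$ (i, c)\<bar> * \<bar>L $$ (j, c)\<bar>"]) auto
    also have "\<dots> \<le> \<bar>L $$ (i, j)\<bar> * L $$ (j, j)"
      using abs_L_recursion[of j i] less.prems by simp
    finally show ?thesis .
  qed
  also have "\<dots> \<le> \<bar>L $$ (i, j)\<bar> * H"
    using ljj by (intro mult_left_mono) auto
  finally show ?case
    using Hpos by (simp add: field_simps)
qed

end

section \<open>Lexicographic numbering of the grid\<close>

lemma less_iff_div_mod:
  fixes m :: nat
  assumes "0 < m"
  shows "i < j \<longleftrightarrow> i div m < j div m \<or> i div m = j div m \<and> i mod m < j mod m"
proof (cases "i div m" "j div m" rule: linorder_cases)
  case less
  then show ?thesis by (metis div_le_mono leD leI)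
next
  case equal
  have "i = i div m * m + i mod m" "j = j div m * m + j mod m" by simp_all
  with equal show ?thesis by (metis add_less_cancel_left less_irrefl)
next
  case greater
  then show ?thesis by (metis div_le_mono leD less_imp_le_nat less_not_sym nat_less_le)
qed

lemma div_less_of_less_square: "i < m\<^sup>2 \<Longrightarrow> i div m < (m::nat)"
  by (simp add: less_mult_imp_div_less power2_eq_square)

lemma block_div_mod:
  fixes m :: nat
  assumes "z < m"
  shows "(K * m + z) div m = K" "(K * m + z) mod m = z"
  using assms by simp_all

lemma block_less_iff:
  fixes m :: nat
  assumes "x < m" "y < m"
  shows "I * m + x < J * m + y \<longleftrightarrow> I < J \<or> I = J \<and> x < y"
proof -
  have "0 < m" using assms by simp
  from less_iff_div_mod[OF this, of "I * m + x" "J * m + y"] show ?thesis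
    unfolding block_div_mod[OF assms(1)] block_div_mod[OF assms(2)] .
qed

lemma block_index_less:
  fixes m :: nat
  assumes "I < m" "x < m"
  shows "I * m + x < m\<^sup>2"
proof -
  have "I * m + x < Suc I * m" using assms by simp
  also have "\<dots> \<le> m * m" using assms by (intro mult_le_mono1) simp
  finally show ?thesis by (simp add: power2_eq_square)
qed

text \<open>
  The graph distance of two points in the five-point grid.
\<close>

definition grid_dist :: "nat \<Rightarrow> nat \<Rightarrow> nat \<Rightarrow> nat" where
  "grid_dist m i j =
     (i mod m - j mod m) + (j mod m - i mod m) + (i div m - j div m) + (j div m - i div m)"

lemma grid_dist_neighbours:
  assumes "neighbours m r s"
  shows "grid_dist m s j \<le> Suc (grid_dist m r j)"
  using assms unfolding neighbours_def grid_dist_def by (elim disjE conjE; linarith)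

lemma neighbours_subset: "{s. neighbours m r s} \<subseteq> {r + 1, r - 1, r + m, r - m}"
proof
  fix s assume "s \<in> {s. neighbours m r s}"
  then consider "r div m = s div m" "r mod m = Suc (s mod m)" | "r div m = s div m" "s mod m = Suc (r mod m)"
    | "r mod m = s mod m" "r div m = Suc (s div m)" | "r mod m = s mod m" "s div m = Suc (r div m)"
    unfolding neighbours_def by blast
  moreover have "r = r div m * m + r mod m" "s = s div m * m + s mod m"
    by simp_all
  ultimately show "s \<in> {r + 1, r - 1, r + m, r - m}"
  proof cases
    case 1
    have "r = Suc s" using \<open>r = _\<close> \<open>s = _\<close> unfolding 1 by linarith
    then show ?thesis by simp
  next
    case 2
    have "s = Suc r" using \<open>r = _\<close> \<open>s = _\<close> unfolding 2 by linarith
    then show ?thesis by simp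
  next
    case 3
    have "r = s + m" using \<open>r = _\<close> \<open>s = _\<close> unfolding 3 mult_Suc by linarith
    then show ?thesis by simp
  next
    case 4
    have "s = r + m" using \<open>r = _\<close> \<open>s = _\<close> unfolding 4 mult_Suc by linarith
    then show ?thesis by simp
  qed
qed

lemma card_neighbours_le: "card {s \<in> B. neighbours m r s} \<le> 4"
proof -
  have "card {s \<in> B. neighbours m r s} \<le> card {r + 1, r - 1, r + m, r - m}"
    using neighbours_subset[of m r] by (intro card_mono) auto
  also have "\<dots> \<le> 4"
    by (intro card_insert_le_m1) simp_all
  finally show ?thesis .
qed

section \<open>Levels of the five-point pattern\<close>

text \<open>
  The closed form of the level. The first case is a diagonal block, which has no fill-in for the
  first grid line; the second case is a block P. Only pairs with j \<le> i are meaningful.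
\<close>

definition grid_level :: "nat \<Rightarrow> nat \<Rightarrow> nat \<Rightarrow> enat" where
  "grid_level m i j =
     (if i div m = j div m then
        if i mod m \<le> Suc (j mod m) then 0
        else if i div m = 0 then \<infinity>
        else enat (i mod m - j mod m + 1)
      else if i div m = Suc (j div m) \<and> i mod m \<le> j mod m then enat (j mod m - i mod m)
      else \<infinity>)"

lemma grid_level_eq_0_iff:
  assumes "0 < m" "j \<le> i"
  shows "grid_level m i j = 0 \<longleftrightarrow> i = j \<or> neighbours m i j"
proof -
  have "i = j \<longleftrightarrow> i div m = j div m \<and> i mod m = j mod m"
    by (metis div_mult_mod_eq)
  moreover have "\<not> i < j" using assms by simp
  ultimately show ?thesis
    using less_iff_div_mod[OF assms(1), of i j] unfolding grid_level_def neighbours_def zero_enat_def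
    by (cases "i div m = j div m"; cases "i div m = Suc (j div m)";
        cases "i mod m" "j mod m" rule: linorder_cases) auto
qed

lemma grid_level_eq_enat_iff:
  "grid_level m i j = enat k \<longleftrightarrow>
     i div m = j div m \<and> i mod m \<le> Suc (j mod m) \<and> k = 0 \<or>
     i div m = j div m \<and> i div m \<noteq> 0 \<and> Suc (j mod m) < i mod m \<and> k = i mod m - j mod m + 1 \<or>
     i div m = Suc (j div m) \<and> i mod m \<le> j mod m \<and> k = j mod m - i mod m"
  unfolding grid_level_def zero_enat_def by auto

text \<open>
  Fill-in of a diagonal block arises from the preceding grid line: the cheapest way to couple two
  points of one grid line through earlier columns is the column of the point in the preceding line
  that is next to the right one of them. Fill-in of a block P arises by prolonging the entry in
  the column before with a coupling of nearest neighbours. Any other column costs at least as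
  much.
\<close>

lemma grid_level_recursion:
  assumes m: "0 < m" and ij: "j < i" and not_nb: "\<not> neighbours m i j"
  shows "(INF c \<in> {..<j}. grid_level m i c + grid_level m j c + 1) = grid_level m i j"
proof (rule antisym)
  define I x J y where "I = i div m" "x = i mod m" "J = j div m" "y = j mod m"
  note ixjy = I_x_J_y_def
  have lt: "J < I \<or> J = I \<and> y < x"
    using less_iff_div_mod[OF m, of j i] ij unfolding ixjy by auto
  have xy: "x < m" "y < m"
    using m unfolding ixjy by auto
  have far: "I = J \<Longrightarrow> y + 2 \<le> x" "I = Suc J \<Longrightarrow> x \<noteq> y"
    using lt not_nb unfolding neighbours_def ixjy[symmetric] by auto
  show "grid_level m i j \<le> (INF c \<in> {..<j}. grid_level m i c + grid_level m j c + 1)"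
  proof (rule INF_greatest)
    fix c assume "c \<in> {..<j}"
    then have before: "c div m < J \<or> c div m = J \<and> c mod m < y"
      using less_iff_div_mod[OF m, of c j] unfolding ixjy by simp
    show "grid_level m i j \<le> grid_level m i c + grid_level m j c + 1"
    proof (cases "grid_level m i c = \<infinity> \<or> grid_level m j c = \<infinity>")
      case True
      then show ?thesis by auto
    next
      case False
      then obtain p q where pq: "grid_level m i c = enat p" "grid_level m j c = enat q"
        by auto
      define K z where "K = c div m" and "z = c mod m"
      note fin = pq[unfolded grid_level_eq_enat_iff, folded ixjy K_def z_def]
      note pos = before[folded K_def z_def]
      consider "I = K" | "I = Suc K"
        using fin(1) by auto
      then have "grid_level m i j \<le> enat (p + q + 1)"
      proof cases
        case 1
        then have "J = I" "z < y" using lt pos by auto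
        then have "x - z + 1 \<le> p" "I \<noteq> 0" using fin(1) far(1) 1 by auto
        then show ?thesis
          using \<open>J = I\<close> \<open>z < y\<close> far(1) unfolding grid_level_def ixjy[symmetric] by simp
      next
        case 2
        then have p: "x \<le> z" "p = z - x" using fin(1) by auto
        consider "J = I" | "J = K" "z < y"
          using pos lt 2 by linarith
        then show ?thesis
        proof cases
          case 1
          then have "y \<le> z" "q = z - y" using fin(2) 2 by auto
          then show ?thesis
            using p 1 2 far(1) unfolding grid_level_def ixjy[symmetric] by simp
        next
          case 2
          then have "y - z \<le> q + 1" using fin(2) by auto
          then show ?thesis
            using p 2 \<open>I = Suc K\<close> unfolding grid_level_def ixjy[symmetric] by simp
        qed
      qed
      then show ?thesis
        by (simp add: pq one_enat_def)
    qed
  qed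
  have witness: "(INF c \<in> {..<j}. grid_level m i c + grid_level m j c + 1) \<le> grid_level m i j"
    if "K * m + z < j" "z < m"
      "grid_level m i (K * m + z) + grid_level m j (K * m + z) + 1 \<le> grid_level m i j" for K z
    using that(3) by (rule INF_lower2[rotated]) (simp add: that)
  have infinite: "grid_level m i j = \<infinity>" if "\<not> (I = J \<and> 0 < I)" "\<not> (I = Suc J \<and> x < y)"
    using that lt far unfolding grid_level_def ixjy[symmetric] by auto
  consider "\<not> (I = J \<and> 0 < I)" "\<not> (I = Suc J \<and> x < y)" | "I = J" "0 < I" | "I = Suc J" "x < y"
    by metis
  then show "(INF c \<in> {..<j}. grid_level m i c + grid_level m j c + 1) \<le> grid_level m i j"
  proof cases
    case 1
    then show ?thesis by (simp add: infinite)
  next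
    case 2
    note 2 = 2 far(1)[OF 2(1)]
    have c: "((I - 1) * m + x) div m = I - 1" "((I - 1) * m + x) mod m = x"
      using xy by simp_all
    have "(I - 1) * m + x < j"
      using 2 c less_iff_div_mod[OF m, of "(I - 1) * m + x" j] unfolding ixjy[symmetric] by simp
    moreover have "grid_level m i ((I - 1) * m + x) = enat 0"
        "grid_level m j ((I - 1) * m + x) = enat (x - y)" "grid_level m i j = enat (x - y + 1)"
      using 2 c unfolding grid_level_def ixjy[symmetric] by simp_all
    ultimately show ?thesis
      using witness[of "I - 1" x] xy by (simp add: one_enat_def)
  next
    case 3
    have c: "(J * m + (y - 1)) div m = J" "(J * m + (y - 1)) mod m = y - 1"
      using xy by simp_all
    have "J * m + (y - 1) < j"
      using 3 c less_iff_div_mod[OF m, of "J * m + (y - 1)" j] unfolding ixjy[symmetric] by simp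
    moreover have "grid_level m i (J * m + (y - 1)) = enat (y - 1 - x)"
        "grid_level m j (J * m + (y - 1)) = enat 0" "grid_level m i j = enat (y - x)"
      using 3 c unfolding grid_level_def ixjy[symmetric] by (simp_all add: zero_enat_def)
    ultimately show ?thesis
      using witness[of J "y - 1"] xy 3 by (simp add: one_enat_def)
  qed
qed

text \<open>
  Induction over the columns: a nonzero entry of A has level 0 on both sides, and all other
  positions satisfy the same recursion.
\<close>

lemma level_eq_grid_level:
  assumes m: "0 < m"
    and nz: "\<And>r s. r < n \<Longrightarrow> s < n \<Longrightarrow> A $$ (r, s) \<noteq> 0 \<longleftrightarrow> r = s \<or> neighbours m r s"
  shows "j \<le> i \<Longrightarrow> i < n \<Longrightarrow> level A i j = grid_level m i j"
proof (induction j arbitrary: i rule: less_induct)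
  case (less j)
  show ?case
  proof (cases "A $$ (i, j) = 0")
    case False
    then show ?thesis
      using less.prems nz[of i j] level_eq_0_iff[of A i j] grid_level_eq_0_iff[OF m, of j i] by simp
  next
    case True
    then have "j < i" "\<not> neighbours m i j"
      using less.prems nz[of i j] by (auto simp: order_le_less)
    have "level A i j = (INF c \<in> {..<j}. level A i c + level A j c + 1)"
      using True by (subst level.simps) (simp only: simp_thms if_False)
    also have "\<dots> = (INF c \<in> {..<j}. grid_level m i c + grid_level m j c + 1)"
      using less by (intro INF_cong) auto
    also have "\<dots> = grid_level m i j"
      using grid_level_recursion[OF m] \<open>j < i\<close> \<open>\<not> neighbours m i j\<close> by simp
    finally show ?thesis .
  qed
qed

lemma grid_level_block:
  assumes "x < m" "y < m"
  shows "grid_level m (I * m + x) (J * m + y) =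
     (if I = J then if x \<le> Suc y then 0 else if I = 0 then \<infinity> else enat (x - y + 1)
      else if I = Suc J \<and> x \<le> y then enat (y - x) else \<infinity>)"
  unfolding grid_level_def block_div_mod[OF assms(1)] block_div_mod[OF assms(2)] by (rule refl)

section \<open>The finite difference matrix for a single mesh\<close>

lemma sum_even_powers_le_2:
  fixes \<tau> :: real
  assumes "0 \<le> \<tau>" "\<tau> \<le> 1 / 2"
  shows "(\<Sum>t<n. \<tau> ^ (2 * t)) \<le> 2"
proof -
  have "(\<Sum>t<n. \<tau> ^ (2 * t)) \<le> (\<Sum>t<n. (1 / 2) ^ t)"
  proof (rule sum_mono)
    fix t
    have "\<tau> ^ (2 * t) \<le> \<tau> ^ t"
      using assms by (intro power_decreasing) auto
    also have "\<dots> \<le> (1 / 2) ^ t"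
      using assms by (intro power_mono) auto
    finally show "\<tau> ^ (2 * t) \<le> (1 / 2) ^ t" .
  qed
  also have "\<dots> \<le> 2"
    by (simp add: geometric_sum)
  finally show ?thesis .
qed

locale fd_cholesky =
  fixes b :: "real \<Rightarrow> real \<Rightarrow> real" and \<beta> :: real and N :: nat and \<epsilon> :: real and L :: "real mat"
  assumes N_ge_2: "2 \<le> N" and eps_pos: "0 < \<epsilon>" and beta_pos: "0 < \<beta>"
    and b_ge: "\<And>x y. 0 < x \<Longrightarrow> x < 1 \<Longrightarrow> 0 < y \<Longrightarrow> y < 1 \<Longrightarrow> \<beta>\<^sup>2 \<le> b x y"
    and L_factor: "cholesky_factor (fd_matrix b N \<epsilon>) L"
begin

abbreviation m :: nat where "m \<equiv> N - 1"
abbreviation h :: real where "h \<equiv> mesh N"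
abbreviation A :: "real mat" where "A \<equiv> fd_matrix b N \<epsilon>"

text \<open>
  The decay per grid step: the four couplings of a point, relative to the lower bound of the
  diagonal of A.
\<close>

definition \<tau> :: real where "\<tau> = 4 * \<epsilon>\<^sup>2 / (\<beta> * h)\<^sup>2"

lemma m_pos: "0 < m"
  using N_ge_2 by simp

lemma h_pos: "0 < h"
  using N_ge_2 by (simp add: mesh_def)

lemma tau_pos: "0 < \<tau>"
  using eps_pos beta_pos h_pos by (simp add: \<tau>_def)

lemma fd_entry:
  assumes "r < m\<^sup>2" "s < m\<^sup>2" "r \<noteq> s"
  shows "A $$ (r, s) = (if neighbours m r s then - (\<epsilon>\<^sup>2) else 0)"
  using assms by (simp add: fd_matrix_def)

lemma interior: "i < m \<Longrightarrow> 0 < real (i + 1) * h \<and> real (i + 1) * h < 1"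
  using N_ge_2 by (auto simp: mesh_def field_simps)

lemma fd_diag_ge:
  assumes "r < m\<^sup>2"
  shows "4 * \<epsilon>\<^sup>2 + (\<beta> * h)\<^sup>2 \<le> A $$ (r, r)"
proof -
  have "\<beta>\<^sup>2 \<le> b (real (r mod m + 1) * h) (real (r div m + 1) * h)"
    using interior[of "r mod m"] interior[of "r div m"] m_pos div_less_of_less_square[OF assms]
    by (intro b_ge) auto
  then have "h\<^sup>2 * \<beta>\<^sup>2 \<le> h\<^sup>2 * b (real (r mod m + 1) * h) (real (r div m + 1) * h)"
    by (intro mult_left_mono) auto
  then show ?thesis
    using assms by (simp add: fd_matrix_def power_mult_distrib mult.commute)
qed

sublocale stieltjes_cholesky "m\<^sup>2" A L
proof
  show "A \<in> carrier_mat (m\<^sup>2) (m\<^sup>2)"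
    by (simp add: fd_matrix_def)
  show "cholesky_factor A L"
    by (rule L_factor)
  show "A $$ (i, j) \<le> 0" if "i < m\<^sup>2" "j < m\<^sup>2" "i \<noteq> j" for i j
    using fd_entry[OF that] by simp
qed

lemma fd_diag_pos: "r < m\<^sup>2 \<Longrightarrow> 0 < A $$ (r, r)"
  using fd_diag_ge[of r] eps_pos by (smt (verit) zero_less_power zero_le_power2)

lemma fd_nonzero_iff:
  assumes "r < m\<^sup>2" "s < m\<^sup>2"
  shows "A $$ (r, s) \<noteq> 0 \<longleftrightarrow> r = s \<or> neighbours m r s"
  using fd_diag_pos[of r] fd_entry[of r s] assms eps_pos by (cases "r = s") auto

lemma level_eq: "j \<le> i \<Longrightarrow> i < m\<^sup>2 \<Longrightarrow> level A i j = grid_level m i j"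
  using level_eq_grid_level[OF m_pos fd_nonzero_iff] .

text \<open>
  One row of A applied to a weight that grows by at most the factor R from a point to its
  neighbours: at most four of them are subtracted, each with the coefficient \<epsilon>^2.
\<close>

lemma weighted_row_sum_ge:
  assumes r: "r < m\<^sup>2" and v: "\<And>s. neighbours m r s \<Longrightarrow> v s \<le> R * v r" and R: "0 \<le> R * v r"
  shows "(A $$ (r, r) - 4 * \<epsilon>\<^sup>2 * R) * v r \<le> (\<Sum>s<m\<^sup>2. A $$ (r, s) * v s)"
proof -
  define B where "B = {s \<in> {..<m\<^sup>2} - {r}. neighbours m r s}"
  have "(\<Sum>s<m\<^sup>2. A $$ (r, s) * v s) = A $$ (r, r) * v r + (\<Sum>s\<in>{..<m\<^sup>2} - {r}. A $$ (r, s) * v s)"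
    using r by (simp add: sum.remove)
  also have "(\<Sum>s\<in>{..<m\<^sup>2} - {r}. A $$ (r, s) * v s) = (\<Sum>s\<in>B. A $$ (r, s) * v s)"
    unfolding B_def using r by (intro sum.mono_neutral_right) (auto simp: fd_entry)
  also have "\<dots> = - (\<epsilon>\<^sup>2 * (\<Sum>s\<in>B. v s))"
    unfolding B_def sum_distrib_left sum_negf[symmetric]
    using r by (intro sum.cong) (auto simp: fd_entry)
  finally have eq: "(\<Sum>s<m\<^sup>2. A $$ (r, s) * v s) = A $$ (r, r) * v r - \<epsilon>\<^sup>2 * (\<Sum>s\<in>B. v s)"
    by simp
  have "(\<Sum>s\<in>B. v s) \<le> real (card B) * (R * v r)"
    using v by (intro sum_bounded_above) (auto simp: B_def)
  also have "\<dots> \<le> 4 * (R * v r)"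
    using card_neighbours_le[of "{..<m\<^sup>2} - {r}" m r] R unfolding B_def[symmetric]
    by (intro mult_right_mono) auto
  finally have "\<epsilon>\<^sup>2 * (\<Sum>s\<in>B. v s) \<le> \<epsilon>\<^sup>2 * (4 * (R * v r))"
    by (intro mult_left_mono) auto
  then show ?thesis
    using eq by (simp add: algebra_simps)
qed

text \<open>
  The row sums of A are at least (\<beta> h)^2, because 4 \<epsilon>^2 on the diagonal compensates all four
  couplings.
\<close>

lemma L_diag_ge: "i < m\<^sup>2 \<Longrightarrow> \<beta> * h \<le> L $$ (i, i)"
proof -
  assume i: "i < m\<^sup>2"
  have row: "(\<beta> * h)\<^sup>2 \<le> (\<Sum>s<m\<^sup>2. A $$ (r, s))" if "r < m\<^sup>2" for r
    using weighted_row_sum_ge[of r "\<lambda>_. 1" 1] fd_diag_ge[of r] that by simp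
  have "(\<beta> * h)\<^sup>2 \<le> (L $$ (i, i))\<^sup>2"
    using L_diag_sq_ge[OF _ i] row i by (meson order_trans zero_le_power2)
  then show ?thesis
    using L_diag_pos[OF i] power2_le_imp_le by fastforce
qed

text \<open>
  The weight grows by the factor 1 / \<tau> per grid step, which is the largest growth for which
  4 \<epsilon>^2 / \<tau> does not exceed the lower bound (\<beta> h)^2 of the diagonal.
\<close>

lemma abs_L_le_decay:
  assumes small: "\<tau> \<le> 1" and ij: "j \<le> i" "i < m\<^sup>2"
  shows "\<bar>L $$ (i, j)\<bar> \<le> L $$ (j, j) * \<tau> ^ grid_dist m i j"
proof -
  define v where "v r = (1 / \<tau>) ^ grid_dist m r j" for r
  have v_pos: "0 < v r" for r
    using tau_pos by (simp add: v_def)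
  have "0 \<le> (\<Sum>s<m\<^sup>2. A $$ (r, s) * v s)" if r: "r < m\<^sup>2" for r
  proof -
    have "v s \<le> (1 / \<tau>) * v r" if "neighbours m r s" for s
      unfolding v_def power_Suc[symmetric] using grid_dist_neighbours[OF that] small tau_pos
      by (intro power_increasing) auto
    moreover have "0 \<le> (1 / \<tau>) * v r"
      using v_pos[of r] tau_pos by simp
    ultimately have "(A $$ (r, r) - 4 * \<epsilon>\<^sup>2 * (1 / \<tau>)) * v r \<le> (\<Sum>s<m\<^sup>2. A $$ (r, s) * v s)"
      using weighted_row_sum_ge[OF r, of v "1 / \<tau>"] by blast
    moreover have "4 * \<epsilon>\<^sup>2 * (1 / \<tau>) = (\<beta> * h)\<^sup>2"
      using eps_pos by (simp add: \<tau>_def)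
    moreover have "0 \<le> (A $$ (r, r) - (\<beta> * h)\<^sup>2) * v r"
      using fd_diag_ge[OF r] v_pos[of r] by (intro mult_nonneg_nonneg) (smt (verit) zero_le_power2)+
    ultimately show ?thesis by simp
  qed
  then have "\<bar>L $$ (i, j)\<bar> * v i \<le> L $$ (j, j) * v j"
    using v_pos ij by (intro abs_L_le_weight_ratio) (auto simp: less_imp_le)
  moreover have "v j = 1"
    by (simp add: v_def grid_dist_def)
  ultimately show ?thesis
    using tau_pos by (simp add: v_def power_divide field_simps)
qed

text \<open>
  The sum in the recursion for an entry of a diagonal block at distance e = x - y, where x and y are
  the positions of i and j in their common grid line. A contributing column in this line lies
  1 + t steps to the left of j, and one in the preceding line lies below a point that is t steps to
  the right of i. In both cases the distances to i and to j add up to e + 2 + 2t.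
\<close>

lemma sum_fill_le:
  assumes small: "\<tau> \<le> 1 / 2" and H: "\<And>i. i < m\<^sup>2 \<Longrightarrow> L $$ (i, i) \<le> H"
    and ij: "j < i" "i < m\<^sup>2" and same_block: "i div m = j div m"
  shows "(\<Sum>c<j. \<bar>L $$ (i, c)\<bar> * \<bar>L $$ (j, c)\<bar>) \<le> 4 * H\<^sup>2 * \<tau> ^ (i mod m - j mod m + 2)"
proof -
  define I x y where "I = i div m" and "x = i mod m" and "y = j mod m"
  have i: "i = I * m + x" and j: "j = I * m + y"
    unfolding I_def x_def y_def using same_block by (metis div_mult_mod_eq)+
  have yx: "y < x" and xm: "x < m"
    using less_iff_div_mod[OF m_pos, of j i] ij same_block m_pos unfolding x_def y_def by simp_all
  \<comment> \<open>columns in the preceding grid line and in the same grid line, parametrised by the excess t\<close>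
  define C1 C2 where "C1 = (\<lambda>t. (I - 1) * m + x + t) ` {..<m - x}" and "C2 = (\<lambda>t. j - 1 - t) ` {..<y}"
  let ?g = "\<lambda>c. H\<^sup>2 * \<tau> ^ (grid_dist m i c + grid_dist m j c)"
  have H_pos: "0 < H"
    using H[OF ij(2)] L_diag_pos[OF ij(2)] by simp
  have entry: "\<bar>L $$ (r, c)\<bar> \<le> H * \<tau> ^ grid_dist m r c" if "c \<le> r" "r < m\<^sup>2" for r c
  proof -
    have "\<bar>L $$ (r, c)\<bar> \<le> L $$ (c, c) * \<tau> ^ grid_dist m r c"
      using abs_L_le_decay small that by simp
    also have "\<dots> \<le> H * \<tau> ^ grid_dist m r c"
      using H[of c] that tau_pos by (intro mult_right_mono) auto
    finally show ?thesis .
  qed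
  have prod: "\<bar>L $$ (i, c)\<bar> * \<bar>L $$ (j, c)\<bar> \<le> ?g c" if "c < j" for c
    using mult_mono[OF entry[of c i] entry[of c j]] that ij H_pos tau_pos
    by (simp add: power2_eq_square power_add mult_ac)
  \<comment> \<open>for I = 0 the set C1 is meaningless, since there is no preceding grid line\<close>
  have support: "(if I = 0 then c \<in> C2 else c \<in> C1 \<union> C2)"
    if c: "c < j" "L $$ (i, c) \<noteq> 0" "L $$ (j, c) \<noteq> 0" for c
  proof -
    have "level A i c \<noteq> \<infinity>"
      using L_eq_0_if_level_infinite[of c i] c ij by auto
    then obtain p where "grid_level m i c = enat p"
      using level_eq[of c i] c ij by auto
    then consider "c div m = I" | "I = Suc (c div m)" "x \<le> c mod m"
      unfolding grid_level_eq_enat_iff I_def x_def by auto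
    then show ?thesis
    proof cases
      case 1
      then have "c = I * m + c mod m" by (metis div_mult_mod_eq)
      then have "c = j - 1 - (j - 1 - c)" "j - 1 - c < y"
        using c(1) j by linarith+
      then have "c \<in> C2" unfolding C2_def by blast
      then show ?thesis by simp
    next
      case 2
      have "c mod m < m" using m_pos by simp
      moreover have "c = (I - 1) * m + c mod m" using 2(1) by (metis diff_Suc_1 div_mult_mod_eq)
      ultimately have "c = (I - 1) * m + x + (c mod m - x)" "c mod m - x < m - x"
        using 2(2) by linarith+
      then have "c \<in> C1" unfolding C1_def by blast
      then show ?thesis using 2(1) by simp
    qed
  qed
  have g_nonneg: "0 \<le> ?g c" for c
    using H_pos tau_pos by simp
  have geometric: "(\<Sum>c\<in>f ` T. ?g c) \<le> 2 * H\<^sup>2 * \<tau> ^ (x - y + 2)"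
    if f: "inj_on f T" "T = {..<n}" "\<And>t. t \<in> T \<Longrightarrow> grid_dist m i (f t) + grid_dist m j (f t) = x - y + 2 + 2 * t"
    for f :: "nat \<Rightarrow> nat" and T n
  proof -
    have "(\<Sum>c\<in>f ` T. ?g c) = (\<Sum>t\<in>T. H\<^sup>2 * \<tau> ^ (x - y + 2) * \<tau> ^ (2 * t))"
      unfolding sum.reindex[OF f(1)]
      by (intro sum.cong refl) (simp only: o_def f(3), simp only: power_add mult.assoc)
    also have "\<dots> = H\<^sup>2 * \<tau> ^ (x - y + 2) * (\<Sum>t<n. \<tau> ^ (2 * t))"
      by (simp only: sum_distrib_left f(2))
    also have "\<dots> \<le> H\<^sup>2 * \<tau> ^ (x - y + 2) * 2"
      using sum_even_powers_le_2[of \<tau> n] small tau_pos by (intro mult_left_mono) auto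
    finally show ?thesis by simp
  qed
  have im: "i div m = I" "i mod m = x" "j div m = I" "j mod m = y"
    unfolding I_def x_def y_def using same_block by simp_all
  have C2: "(\<Sum>c\<in>C2. ?g c) \<le> 2 * H\<^sup>2 * \<tau> ^ (x - y + 2)"
    unfolding C2_def
  proof (rule geometric[where n = y])
    show "inj_on (\<lambda>t. j - 1 - t) {..<y}"
      using j by (auto simp: inj_on_def)
    fix t assume "t \<in> {..<y}"
    then have c: "j - 1 - t = I * m + (y - 1 - t)" and "y - 1 - t < m" and ty: "t < y"
      using j yx xm by auto
    have "(j - 1 - t) div m = I" "(j - 1 - t) mod m = y - 1 - t"
      unfolding c by (rule block_div_mod[OF \<open>y - 1 - t < m\<close>])+
    then show "grid_dist m i (j - 1 - t) + grid_dist m j (j - 1 - t) = x - y + 2 + 2 * t"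
      unfolding grid_dist_def im using ty yx by simp
  qed simp
  have C1: "(\<Sum>c\<in>C1. ?g c) \<le> 2 * H\<^sup>2 * \<tau> ^ (x - y + 2)" if "I \<noteq> 0"
    unfolding C1_def
  proof (rule geometric[where n = "m - x"])
    fix t assume t: "t \<in> {..<m - x}"
    then have "x + t < m" by simp
    then have "((I - 1) * m + (x + t)) div m = I - 1" "((I - 1) * m + (x + t)) mod m = x + t"
      by (rule block_div_mod)+
    then show "grid_dist m i ((I - 1) * m + x + t) + grid_dist m j ((I - 1) * m + x + t) = x - y + 2 + 2 * t"
      unfolding grid_dist_def im add.assoc using yx that by simp
  qed (simp_all add: inj_on_def)
  define S where "S = (if I = 0 then C2 else C1 \<union> C2)"
  have fin: "finite C1" "finite C2" unfolding C1_def C2_def by auto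
  have "(\<Sum>c<j. \<bar>L $$ (i, c)\<bar> * \<bar>L $$ (j, c)\<bar>) =
      (\<Sum>c\<in>{c\<in>{..<j}. L $$ (i, c) \<noteq> 0 \<and> L $$ (j, c) \<noteq> 0}. \<bar>L $$ (i, c)\<bar> * \<bar>L $$ (j, c)\<bar>)"
    by (intro sum.mono_neutral_right) auto
  also have "\<dots> \<le> (\<Sum>c\<in>{c\<in>{..<j}. L $$ (i, c) \<noteq> 0 \<and> L $$ (j, c) \<noteq> 0}. ?g c)"
    using prod by (intro sum_mono) auto
  also have "\<dots> \<le> (\<Sum>c\<in>S. ?g c)"
  proof (rule sum_mono2)
    show "{c\<in>{..<j}. L $$ (i, c) \<noteq> 0 \<and> L $$ (j, c) \<noteq> 0} \<subseteq> S"
      using support unfolding S_def by (cases "I = 0") (simp_all, blast+)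
  qed (use fin g_nonneg in \<open>simp_all add: S_def\<close>)
  also have "\<dots> \<le> 4 * H\<^sup>2 * \<tau> ^ (x - y + 2)"
  proof (cases "I = 0")
    case True
    have "(\<Sum>c\<in>C2. ?g c) \<le> 2 * (2 * H\<^sup>2 * \<tau> ^ (x - y + 2))"
      using C2 g_nonneg tau_pos by (smt (verit) sum_nonneg)
    then show ?thesis
      using True by (simp add: S_def)
  next
    case False
    have "(\<Sum>c\<in>C1 \<union> C2. ?g c) \<le> (\<Sum>c\<in>C1. ?g c) + (\<Sum>c\<in>C2. ?g c)"
      using sum_nonneg[of "C1 \<inter> C2" ?g, OF g_nonneg] unfolding sum_Un[OF fin] by linarith
    then show ?thesis
      using False C1 C2 by (simp add: S_def)
  qed
  finally show ?thesis
    unfolding x_def y_def .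
qed

text \<open>
  For couplings of level 0 and for the blocks P, the decay estimate alone has the exponent k + 1.
  For the fill-in of the diagonal blocks one more step of the recursion supplies it.
\<close>

lemma abs_L_le_if_level_finite:
  assumes small: "\<tau> \<le> 1 / 2" and H: "\<And>i. i < m\<^sup>2 \<Longrightarrow> L $$ (i, i) \<le> H"
    and ij: "j < i" "i < m\<^sup>2" and level: "level A i j = enat k"
  shows "\<bar>L $$ (i, j)\<bar> \<le> 4 * H\<^sup>2 / (\<beta> * h) * \<tau> ^ (k + 1)"
proof -
  have D: "0 < \<beta> * h" "\<beta> * h \<le> L $$ (j, j)" "L $$ (j, j) \<le> H"
    using beta_pos h_pos L_diag_ge[of j] H[of j] ij by auto
  have grid: "grid_level m i j = enat k"
    using level level_eq[of j i] ij by simp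
  have lt: "j div m < i div m \<or> j div m = i div m \<and> j mod m < i mod m"
    using less_iff_div_mod[OF m_pos, of j i] ij by simp
  have "\<bar>L $$ (i, j)\<bar> * (\<beta> * h) \<le> 4 * H\<^sup>2 * \<tau> ^ (k + 1)"
  proof (cases "i div m = j div m \<and> k \<noteq> 0")
    case True
    then have k: "k = i mod m - j mod m + 1"
      using grid unfolding grid_level_eq_enat_iff by auto
    have "A $$ (i, j) = 0"
      using level True level_eq_0_iff[of A i j] by (auto simp: zero_enat_def)
    then have "\<bar>L $$ (i, j)\<bar> * L $$ (j, j) \<le> 4 * H\<^sup>2 * \<tau> ^ (k + 1)"
      using abs_L_recursion[OF ij] sum_fill_le[OF small H ij] True unfolding k by simp
    then show ?thesis
      using mult_left_mono[OF D(2), of "\<bar>L $$ (i, j)\<bar>"] by simp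
  next
    case False
    then have "grid_dist m i j = k + 1"
      using grid lt unfolding grid_level_eq_enat_iff grid_dist_def by auto
    then have "\<bar>L $$ (i, j)\<bar> \<le> L $$ (j, j) * \<tau> ^ (k + 1)"
      using abs_L_le_decay[of j i] small ij by simp
    also have "\<dots> \<le> H * \<tau> ^ (k + 1)"
      using D tau_pos by (intro mult_right_mono) auto
    finally have "\<bar>L $$ (i, j)\<bar> * (\<beta> * h) \<le> H * \<tau> ^ (k + 1) * H"
      using D tau_pos by (intro mult_mono) auto
    also have "\<dots> \<le> 4 * H\<^sup>2 * \<tau> ^ (k + 1)"
      using tau_pos D by (simp add: power2_eq_square)
    finally show ?thesis .
  qed
  then show ?thesis
    using D(1) by (simp add: field_simps)
qed

lemma L_diag_le:
  assumes K: "0 < K" and i: "i < m\<^sup>2" "A $$ (i, i) \<le> K * h\<^sup>2"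
  shows "L $$ (i, i) \<le> sqrt K * h"
proof (rule power2_le_imp_le)
  have "(sqrt K * h)\<^sup>2 = K * h\<^sup>2"
    using K by (simp only: power_mult_distrib real_sqrt_pow2 less_imp_le)
  then show "(L $$ (i, i))\<^sup>2 \<le> (sqrt K * h)\<^sup>2"
    using L_diag_sq_le[OF i(1)] i(2) by linarith
  show "0 \<le> sqrt K * h"
    using K h_pos by simp
qed

text \<open>
  The constants depend on k, \<beta> and K, but not on N and \<epsilon>. The hypothesis 3 \<epsilon> \<le> \<beta> h ensures
  \<tau> \<le> 1/2.
\<close>

lemma abs_L_bounds:
  assumes K: "0 < K" and diag: "\<And>i. i < m\<^sup>2 \<Longrightarrow> A $$ (i, i) \<le> K * h\<^sup>2" and small: "3 * \<epsilon> \<le> \<beta> * h"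
    and ij: "j < i" "i < m\<^sup>2" and level: "level A i j = enat k"
  shows "1 / sqrt K ^ (2 * k + 1) * (\<epsilon> ^ (2 * (k + 1)) / h ^ (2 * k + 1)) \<le> \<bar>L $$ (i, j)\<bar>"
    and "\<bar>L $$ (i, j)\<bar> \<le> 4 * K / \<beta> * (4 / \<beta>\<^sup>2) ^ (k + 1) * (\<epsilon> ^ (2 * (k + 1)) / h ^ (2 * k + 1))"
proof -
  have H: "L $$ (i, i) \<le> sqrt K * h" if "i < m\<^sup>2" for i
    using L_diag_le[OF K that diag[OF that]] .
  have "(\<epsilon>\<^sup>2) ^ (k + 1) / (sqrt K * h) ^ (2 * k + 1) \<le> \<bar>L $$ (i, j)\<bar>"
    by (rule abs_L_ge_if_level_finite[OF _ _ H ij level]) (auto simp: fd_entry split: if_splits)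
  then show "1 / sqrt K ^ (2 * k + 1) * (\<epsilon> ^ (2 * (k + 1)) / h ^ (2 * k + 1)) \<le> \<bar>L $$ (i, j)\<bar>"
    by (simp only: power_mult_distrib power_mult[symmetric] times_divide_times_eq mult_1)
  have "9 * \<epsilon>\<^sup>2 \<le> (\<beta> * h)\<^sup>2"
    using power_mono[OF small, of 2] eps_pos by (simp add: power_mult_distrib)
  then have "8 * \<epsilon>\<^sup>2 \<le> (\<beta> * h)\<^sup>2"
    using zero_le_power2[of \<epsilon>] by linarith
  moreover have "0 < (\<beta> * h)\<^sup>2"
    using beta_pos h_pos by simp
  ultimately have "\<tau> \<le> 1 / 2"
    unfolding \<tau>_def by (simp add: divide_le_eq)
  then have "\<bar>L $$ (i, j)\<bar> \<le> 4 * (sqrt K * h)\<^sup>2 / (\<beta> * h) * \<tau> ^ (k + 1)"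
    using abs_L_le_if_level_finite[OF _ H ij level] by simp
  also have "\<dots> = 4 * K / \<beta> * (4 / \<beta>\<^sup>2) ^ (k + 1) * (\<epsilon> ^ (2 * (k + 1)) / h ^ (2 * k + 1))"
  proof -
    have "\<tau> ^ (k + 1) = (4 / \<beta>\<^sup>2) ^ (k + 1) * (\<epsilon> ^ (2 * (k + 1)) / (h ^ (2 * k + 1) * h))"
    proof -
      have "\<tau> = 4 / \<beta>\<^sup>2 * (\<epsilon>\<^sup>2 / h\<^sup>2)"
        by (simp add: \<tau>_def power_mult_distrib)
      then have "\<tau> ^ (k + 1) = (4 / \<beta>\<^sup>2) ^ (k + 1) * (\<epsilon> ^ (2 * (k + 1)) / h ^ (2 * (k + 1)))"
        by (simp only: power_mult_distrib power_divide[of "\<epsilon>\<^sup>2"] power_mult)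
      moreover have "h ^ (2 * (k + 1)) = h ^ (2 * k + 1) * h"
        by simp
      ultimately show ?thesis by (simp only:)
    qed
    moreover have "4 * (sqrt K * h)\<^sup>2 / (\<beta> * h) = 4 * K / \<beta> * h"
      using K h_pos by (simp add: power_mult_distrib power2_eq_square)
    moreover have "a * h * (c * (e / (g * h))) = a * c * (e / g)" for a c e g :: real
      using h_pos by simp
    ultimately show ?thesis
      by (simp only:)
  qed
  finally show "\<bar>L $$ (i, j)\<bar> \<le> 4 * K / \<beta> * (4 / \<beta>\<^sup>2) ^ (k + 1) * (\<epsilon> ^ (2 * (k + 1)) / h ^ (2 * k + 1))" .
qed

lemma level_set_iff: "(i, j) \<in> level_set A k \<longleftrightarrow> j \<le> i \<and> i < m\<^sup>2 \<and> grid_level m i j = k"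
  using A_carrier level_eq[of j i] by (auto simp: level_set_def)

lemma L_eq_0_if_grid_level_infinite:
  assumes "i < m\<^sup>2" "j < m\<^sup>2" "i < j \<or> grid_level m i j = \<infinity>"
  shows "L $$ (i, j) = 0"
proof (cases "i < j")
  case True
  then show ?thesis using assms L_upper_zero by blast
next
  case False
  then have "i \<noteq> j" using assms(3) by (auto simp: grid_level_def)
  then have "j < i" using False by simp
  then show ?thesis
    using L_eq_0_if_level_infinite[of j i] level_eq[of j i] assms False by simp
qed

text \<open>
  Any bound of the diagonal entries of L, for instance their sum, makes the lower bound applicable.
\<close>

lemma L_nonzero_if_level_finite:
  assumes "j \<le> i" "i < m\<^sup>2" "level A i j = enat k"
  shows "L $$ (i, j) \<noteq> 0"
proof (cases "i = j")
  case True
  then show ?thesis using L_diag_pos[of j] assms by simp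
next
  case False
  then have "j < i" using assms by simp
  define H where "H = (\<Sum>c<m\<^sup>2. L $$ (c, c))"
  have H: "L $$ (c, c) \<le> H" if "c < m\<^sup>2" for c
    unfolding H_def using that L_diag_pos
    by (intro member_le_sum[where f = "\<lambda>c. L $$ (c, c)"]) (auto simp: less_imp_le)
  then have "0 < H"
    using L_diag_pos[OF assms(2)] assms(2) by (meson less_le_trans)
  moreover have "(\<epsilon>\<^sup>2) ^ (k + 1) / H ^ (2 * k + 1) \<le> \<bar>L $$ (i, j)\<bar>"
    by (rule abs_L_ge_if_level_finite[OF _ _ H \<open>j < i\<close> assms(2,3)])
      (auto simp: fd_entry split: if_splits)
  ultimately have "0 < \<bar>L $$ (i, j)\<bar>"
    using eps_pos by (smt (verit) divide_pos_pos zero_less_power)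
  then show ?thesis by simp
qed

lemma L_eq_0_iff_level_infinite:
  assumes "j \<le> i" "i < m\<^sup>2"
  shows "L $$ (i, j) = 0 \<longleftrightarrow> level A i j = \<infinity>"
proof
  show "level A i j = \<infinity>" if "L $$ (i, j) = 0"
    using L_nonzero_if_level_finite[OF assms] that by (cases "level A i j") auto
  show "L $$ (i, j) = 0" if "level A i j = \<infinity>"
    using L_eq_0_if_grid_level_infinite[of i j] level_eq[OF assms] assms that by simp
qed

text \<open>
  No fill-in entry has a level above m: the levels are at most m - 1 in the blocks P, and at most m
  in the blocks Q.
\<close>

lemma fill_in_eq: "fill_in A L = (\<Union>k \<in> {1..m}. level_set A (enat k))"
proof (rule Set.set_eqI)
  fix p :: "nat \<times> nat"
  obtain i j where p: "p = (i, j)" by (cases p)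
  have "(i, j) \<in> fill_in A L \<longleftrightarrow> (\<exists>k \<in> {1..m}. (i, j) \<in> level_set A (enat k))"
  proof
    assume "(i, j) \<in> fill_in A L"
    then have ij: "i < m\<^sup>2" "j < m\<^sup>2" and zero: "A $$ (i, j) = 0" and nonzero: "L $$ (i, j) \<noteq> 0"
      using A_carrier by (auto simp: fill_in_def)
    have le: "j \<le> i"
      using nonzero ij L_upper_zero by (metis not_le)
    obtain k where k: "level A i j = enat k"
      using nonzero L_eq_0_iff_level_infinite[OF le ij(1)] by (cases "level A i j") auto
    have "k \<noteq> 0"
      using k zero level_eq_0_iff[of A i j] by (auto simp: zero_enat_def)
    moreover have grid: "grid_level m i j = enat k"
      using k level_eq[OF le ij(1)] by simp
    moreover have "i mod m < m" "j mod m < m"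
      using m_pos by simp_all
    ultimately have "k \<in> {1..m}"
      unfolding grid_level_eq_enat_iff atLeastAtMost_iff by linarith
    then show "\<exists>k \<in> {1..m}. (i, j) \<in> level_set A (enat k)"
      using grid le ij level_set_iff by blast
  next
    assume "\<exists>k \<in> {1..m}. (i, j) \<in> level_set A (enat k)"
    then obtain k where "1 \<le> k" and ij: "j \<le> i" "i < m\<^sup>2" and k: "level A i j = enat k"
      using A_carrier by (auto simp: level_set_def)
    then have "A $$ (i, j) = 0"
      using level_eq_0_iff[of A i j] by (auto simp: zero_enat_def)
    then show "(i, j) \<in> fill_in A L"
      using L_nonzero_if_level_finite[OF ij k] ij A_carrier by (auto simp: fill_in_def)
  qed
  then show "p \<in> fill_in A L \<longleftrightarrow> p \<in> (\<Union>k \<in> {1..m}. level_set A (enat k))"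
    unfolding p by blast
qed

end

section \<open>Uniformity in the mesh and the perturbation parameter\<close>

lemma same_orderI:
  assumes "0 < C0" "0 < C1"
    and "\<And>s. s \<in> S \<Longrightarrow> C0 * \<bar>g s\<bar> \<le> \<bar>f s\<bar> \<and> \<bar>f s\<bar> \<le> C1 * \<bar>g s\<bar>"
  shows "same_order S f g"
  unfolding same_order_def using assms by blast

text \<open>
  The factors for all parameters in a regime, with one constant K that bounds the diagonal of A
  for all of them. The constants of the magnitude relations may depend on \<beta> and K only, apart from
  the level.
\<close>

locale fd_family =
  fixes b :: "real \<Rightarrow> real \<Rightarrow> real" and \<beta> \<delta> K :: real and L :: "nat \<Rightarrow> real \<Rightarrow> real mat"
  assumes member: "\<And>N \<epsilon>. (N, \<epsilon>) \<in> regime \<delta> \<Longrightarrow> fd_cholesky b \<beta> N \<epsilon> (L N \<epsilon>)"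
    and beta_pos: "0 < \<beta>" and delta_le: "3 * \<delta> \<le> \<beta>" and K_pos: "0 < K"
    and diag_le: "\<And>N \<epsilon> i. (N, \<epsilon>) \<in> regime \<delta> \<Longrightarrow> i < (N - 1)\<^sup>2 \<Longrightarrow>
      fd_matrix b N \<epsilon> $$ (i, i) \<le> K * (mesh N)\<^sup>2"
begin

lemma regime_small: "(N, \<epsilon>) \<in> regime \<delta> \<Longrightarrow> 3 * \<epsilon> \<le> \<beta> * mesh N"
proof -
  assume r: "(N, \<epsilon>) \<in> regime \<delta>"
  then have "\<epsilon> \<le> \<delta> * mesh N" by (simp add: regime_def)
  moreover have "3 * \<delta> * mesh N \<le> \<beta> * mesh N"
    using delta_le fd_cholesky.h_pos[OF member[OF r]] by (intro mult_right_mono) auto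
  ultimately show ?thesis by linarith
qed

lemma same_order_diag:
  assumes "\<And>s. s \<in> S \<Longrightarrow> \<exists>N \<epsilon> i. (N, \<epsilon>) \<in> regime \<delta> \<and> i < (N - 1)\<^sup>2 \<and>
    f s = L N \<epsilon> $$ (i, i) \<and> g s = mesh N"
  shows "same_order S f g"
proof (rule same_orderI)
  show "0 < \<beta>" "0 < sqrt K"
    using beta_pos K_pos by simp_all
  fix s assume "s \<in> S"
  then obtain N \<epsilon> i where s: "(N, \<epsilon>) \<in> regime \<delta>" "i < (N - 1)\<^sup>2" "f s = L N \<epsilon> $$ (i, i)" "g s = mesh N"
    using assms by blast
  interpret fd_cholesky b \<beta> N \<epsilon> "L N \<epsilon>"
    by (rule member[OF s(1)])
  show "\<beta> * \<bar>g s\<bar> \<le> \<bar>f s\<bar> \<and> \<bar>f s\<bar> \<le> sqrt K * \<bar>g s\<bar>"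
    using L_diag_ge[OF s(2)] L_diag_le[OF K_pos s(2) diag_le[OF s(1,2)]] L_diag_pos[OF s(2)] h_pos
    unfolding s(3,4) by simp
qed

lemma same_order_offdiag:
  assumes "\<And>s. s \<in> S \<Longrightarrow> \<exists>N \<epsilon> i j. (N, \<epsilon>) \<in> regime \<delta> \<and> j < i \<and> i < (N - 1)\<^sup>2 \<and>
    grid_level (N - 1) i j = enat k \<and> f s = L N \<epsilon> $$ (i, j) \<and>
    g s = \<epsilon> ^ (2 * (k + 1)) / mesh N ^ (2 * k + 1)"
  shows "same_order S f g"
proof (rule same_orderI)
  show "0 < 1 / sqrt K ^ (2 * k + 1)" "0 < 4 * K / \<beta> * (4 / \<beta>\<^sup>2) ^ (k + 1)"
    using beta_pos K_pos by simp_all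
  fix s assume "s \<in> S"
  then obtain N \<epsilon> i j where s: "(N, \<epsilon>) \<in> regime \<delta>" "j < i" "i < (N - 1)\<^sup>2"
    "grid_level (N - 1) i j = enat k" "f s = L N \<epsilon> $$ (i, j)"
    "g s = \<epsilon> ^ (2 * (k + 1)) / mesh N ^ (2 * k + 1)"
    using assms by blast
  interpret fd_cholesky b \<beta> N \<epsilon> "L N \<epsilon>"
    by (rule member[OF s(1)])
  have level: "level A i j = enat k"
    using level_eq[of j i] s(2-4) by simp
  have "\<bar>g s\<bar> = \<epsilon> ^ (2 * (k + 1)) / h ^ (2 * k + 1)"
    unfolding s(6) using eps_pos h_pos by (intro abs_of_nonneg divide_nonneg_nonneg zero_le_power) auto
  then show "1 / sqrt K ^ (2 * k + 1) * \<bar>g s\<bar> \<le> \<bar>f s\<bar> \<and> \<bar>f s\<bar> \<le> 4 * K / \<beta> * (4 / \<beta>\<^sup>2) ^ (k + 1) * \<bar>g s\<bar>"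
    using abs_L_bounds[OF K_pos diag_le[OF s(1)] regime_small[OF s(1)] s(2,3) level] unfolding s(5)
    by simp
qed

lemma L_block_eq_0:
  assumes "(N, \<epsilon>) \<in> regime \<delta>" "I < N - 1" "J < N - 1" "x < N - 1" "y < N - 1"
    and "I < J \<or> I = J \<and> x < y \<or> grid_level (N - 1) (I * (N - 1) + x) (J * (N - 1) + y) = \<infinity>"
  shows "L N \<epsilon> $$ block_pos (N - 1) I J x y = 0"
proof -
  interpret fd_cholesky b \<beta> N \<epsilon> "L N \<epsilon>"
    by (rule member[OF assms(1)])
  have "I * m + x < J * m + y \<or> grid_level m (I * m + x) (J * m + y) = \<infinity>"
    using assms(6) block_less_iff[OF assms(4,5), of I J] by argo
  then show ?thesis
    unfolding block_pos_def
    by (rule L_eq_0_if_grid_level_infinite[OF block_index_less[OF assms(2,4)] block_index_less[OF assms(3,5)]])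
qed

lemma block_in_level_set:
  assumes "(N, \<epsilon>) \<in> regime \<delta>" "I < N - 1" "x < N - 1" "y < N - 1" "J < I \<or> I = J \<and> y < x"
    and "grid_level (N - 1) (I * (N - 1) + x) (J * (N - 1) + y) = enat k"
  shows "block_pos (N - 1) I J x y \<in> level_set (fd_matrix b N \<epsilon>) (enat k)"
proof -
  have "J * (N - 1) + y < I * (N - 1) + x"
    using assms(5) block_less_iff[OF assms(4,3)] by blast
  then show ?thesis
    unfolding block_pos_def fd_cholesky.level_set_iff[OF member[OF assms(1)]]
    using assms(6) block_index_less[OF assms(2,3)] by (blast intro: less_imp_le)
qed

lemma same_order_block_diag:
  assumes "\<And>s. s \<in> S \<Longrightarrow> \<exists>N \<epsilon> I x. (N, \<epsilon>) \<in> regime \<delta> \<and> I < N - 1 \<and> x < N - 1 \<and>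
    f s = L N \<epsilon> $$ block_pos (N - 1) I I x x \<and> g s = mesh N"
  shows "same_order S f g"
proof (rule same_order_diag)
  fix s assume "s \<in> S"
  from assms[OF this] show "\<exists>N \<epsilon> i. (N, \<epsilon>) \<in> regime \<delta> \<and> i < (N - 1)\<^sup>2 \<and>
      f s = L N \<epsilon> $$ (i, i) \<and> g s = mesh N"
    unfolding block_pos_def using block_index_less by blast
qed

text \<open>
  The nonzero couplings of A itself are the first subdiagonals of the diagonal blocks and the
  diagonals of the blocks P.
\<close>

lemma same_order_block_coupling:
  assumes "\<And>s. s \<in> S \<Longrightarrow> \<exists>N \<epsilon> I J x y. (N, \<epsilon>) \<in> regime \<delta> \<and> I < N - 1 \<and> x < N - 1 \<and>
    (I = J \<and> x = Suc y \<or> I = Suc J \<and> x = y) \<and>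
    f s = L N \<epsilon> $$ block_pos (N - 1) I J x y \<and> g s = \<epsilon>\<^sup>2 / mesh N"
  shows "same_order S f g"
proof (rule same_order_offdiag[where k = 0])
  fix s assume "s \<in> S"
  from assms[OF this] obtain N \<epsilon> I J x y where r: "(N, \<epsilon>) \<in> regime \<delta>"
    and I: "I < N - 1" and x: "x < N - 1" and near: "I = J \<and> x = Suc y \<or> I = Suc J \<and> x = y"
    and fg: "f s = L N \<epsilon> $$ block_pos (N - 1) I J x y" "g s = \<epsilon>\<^sup>2 / mesh N"
    by blast
  have y: "y < N - 1"
    using x near by auto
  have "J * (N - 1) + y < I * (N - 1) + x"
    using near block_less_iff[OF y x] by auto
  moreover have "grid_level (N - 1) (I * (N - 1) + x) (J * (N - 1) + y) = enat 0"
    using near unfolding grid_level_block[OF x y] by (auto simp: zero_enat_def)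
  moreover have "g s = \<epsilon> ^ (2 * (0 + 1)) / mesh N ^ (2 * 0 + 1)"
    using fg(2) by simp
  ultimately show "\<exists>N \<epsilon> i j. (N, \<epsilon>) \<in> regime \<delta> \<and> j < i \<and> i < (N - 1)\<^sup>2 \<and>
      grid_level (N - 1) i j = enat 0 \<and> f s = L N \<epsilon> $$ (i, j) \<and>
      g s = \<epsilon> ^ (2 * (0 + 1)) / mesh N ^ (2 * 0 + 1)"
    using r block_index_less[OF I x] fg(1) unfolding block_pos_def by blast
qed

lemma same_order_level_set:
  assumes k: "1 \<le> k"
  shows "same_order {(N, \<epsilon>, i, j). (N, \<epsilon>) \<in> regime \<delta> \<and> k \<le> N - 1 \<and>
      (i, j) \<in> level_set (fd_matrix b N \<epsilon>) (enat k)}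
    (\<lambda>(N, \<epsilon>, i, j). L N \<epsilon> $$ (i, j)) (\<lambda>(N, \<epsilon>, i, j). \<epsilon>^(2*(k+1)) / (mesh N)^(2*k+1))"
proof (rule same_order_offdiag[where k = k], clarify)
  fix N \<epsilon> i j
  assume r: "(N, \<epsilon>) \<in> regime \<delta>" and mem: "(i, j) \<in> level_set (fd_matrix b N \<epsilon>) (enat k)"
  then have ij: "j \<le> i" "i < (N - 1)\<^sup>2" "grid_level (N - 1) i j = enat k"
    using fd_cholesky.level_set_iff[OF member[OF r]] by blast+
  moreover have "i \<noteq> j"
    using ij(3) k by (auto simp: grid_level_def zero_enat_def)
  ultimately have "j < i" by simp
  then show "\<exists>N' \<epsilon>' i' j'. (N', \<epsilon>') \<in> regime \<delta> \<and> j' < i' \<and> i' < (N' - 1)\<^sup>2 \<and>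
      grid_level (N' - 1) i' j' = enat k \<and> L N \<epsilon> $$ (i, j) = L N' \<epsilon>' $$ (i', j') \<and>
      \<epsilon> ^ (2 * (k + 1)) / mesh N ^ (2 * k + 1) = \<epsilon>' ^ (2 * (k + 1)) / mesh N' ^ (2 * k + 1)"
    using r ij by blast
qed

end

section \<open>The fill-in of the Cholesky factor\<close>

theorem theorem1:
  fixes b :: "real \<Rightarrow> real \<Rightarrow> real"
    and \<beta> :: real
    and L :: "nat \<Rightarrow> real \<Rightarrow> real mat"
  assumes beta: "0 < \<beta>^2"
    and b_lower: "\<And>x y. 0 < x \<Longrightarrow> x < 1 \<Longrightarrow> 0 < y \<Longrightarrow> y < 1 \<Longrightarrow> \<beta>^2 \<le> b x y"
    and diagonal: "\<exists>\<delta>1 > 0. same_order {(N, \<epsilon>, i). (N, \<epsilon>) \<in> regime \<delta>1 \<and> i < (N - 1)^2}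
          (\<lambda>(N, \<epsilon>, i). fd_matrix b N \<epsilon> $$ (i, i)) (\<lambda>(N, \<epsilon>, i). (mesh N)^2)"
    and cholesky: "\<And>N \<epsilon>. 2 \<le> N \<Longrightarrow> 0 < \<epsilon> \<Longrightarrow> cholesky_factor (fd_matrix b N \<epsilon>) (L N \<epsilon>)"
  shows "\<exists>\<delta>0 > 0.
    \<comment> \<open>zero blocks\<close>
    (\<forall>(N, \<epsilon>) \<in> regime \<delta>0. \<forall>I < N - 1. \<forall>J < N - 1. I \<noteq> J \<and> I \<noteq> Suc J \<longrightarrow>
       (\<forall>x < N - 1. \<forall>y < N - 1. L N \<epsilon> $$ block_pos (N - 1) I J x y = 0)) \<and>
    \<comment> \<open>pattern M\<close>
    (\<forall>(N, \<epsilon>) \<in> regime \<delta>0. \<forall>x < N - 1. \<forall>y < N - 1. x \<noteq> y \<and> x \<noteq> Suc y \<longrightarrow>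
       L N \<epsilon> $$ block_pos (N - 1) 0 0 x y = 0) \<and>
    same_order {(N, \<epsilon>, x). (N, \<epsilon>) \<in> regime \<delta>0 \<and> x < N - 1}
      (\<lambda>(N, \<epsilon>, x). L N \<epsilon> $$ block_pos (N - 1) 0 0 x x) (\<lambda>(N, \<epsilon>, x). mesh N) \<and>
    same_order {(N, \<epsilon>, x). (N, \<epsilon>) \<in> regime \<delta>0 \<and> Suc x < N - 1}
      (\<lambda>(N, \<epsilon>, x). L N \<epsilon> $$ block_pos (N - 1) 0 0 (Suc x) x) (\<lambda>(N, \<epsilon>, x). \<epsilon>^2 / mesh N) \<and>
    \<comment> \<open>pattern P\<close>
    (\<forall>(N, \<epsilon>) \<in> regime \<delta>0. \<forall>I. Suc I < N - 1 \<longrightarrow> (\<forall>x < N - 1. \<forall>y < x.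
       L N \<epsilon> $$ block_pos (N - 1) (Suc I) I x y = 0)) \<and>
    same_order {(N, \<epsilon>, I, x). (N, \<epsilon>) \<in> regime \<delta>0 \<and> Suc I < N - 1 \<and> x < N - 1}
      (\<lambda>(N, \<epsilon>, I, x). L N \<epsilon> $$ block_pos (N - 1) (Suc I) I x x)
      (\<lambda>(N, \<epsilon>, I, x). \<epsilon>^2 / mesh N) \<and>
    (\<forall>(N, \<epsilon>) \<in> regime \<delta>0. \<forall>I. Suc I < N - 1 \<longrightarrow> (\<forall>y < N - 1. \<forall>x < y.
       block_pos (N - 1) (Suc I) I x y \<in> level_set (fd_matrix b N \<epsilon>) (enat (y - x)))) \<and>
    \<comment> \<open>pattern Q\<close>
    (\<forall>(N, \<epsilon>) \<in> regime \<delta>0. \<forall>I < N - 1. 0 < I \<longrightarrow> (\<forall>y < N - 1. \<forall>x < y.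
       L N \<epsilon> $$ block_pos (N - 1) I I x y = 0)) \<and>
    same_order {(N, \<epsilon>, I, x). (N, \<epsilon>) \<in> regime \<delta>0 \<and> 0 < I \<and> I < N - 1 \<and> x < N - 1}
      (\<lambda>(N, \<epsilon>, I, x). L N \<epsilon> $$ block_pos (N - 1) I I x x) (\<lambda>(N, \<epsilon>, I, x). mesh N) \<and>
    same_order {(N, \<epsilon>, I, x). (N, \<epsilon>) \<in> regime \<delta>0 \<and> 0 < I \<and> I < N - 1 \<and> Suc x < N - 1}
      (\<lambda>(N, \<epsilon>, I, x). L N \<epsilon> $$ block_pos (N - 1) I I (Suc x) x)
      (\<lambda>(N, \<epsilon>, I, x). \<epsilon>^2 / mesh N) \<and>
    (\<forall>(N, \<epsilon>) \<in> regime \<delta>0. \<forall>I < N - 1. 0 < I \<longrightarrow> (\<forall>x < N - 1. \<forall>y. y + 2 \<le> x \<longrightarrow>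
       block_pos (N - 1) I I x y \<in> level_set (fd_matrix b N \<epsilon>) (enat (x - y + 1)))) \<and>
    \<comment> \<open>zero entries and fill-in in terms of the magnitude classes\<close>
    (\<forall>(N, \<epsilon>) \<in> regime \<delta>0. \<forall>i < (N - 1)^2. \<forall>j \<le> i. L N \<epsilon> $$ (i, j) = 0 \<longrightarrow>
       (i, j) \<in> level_set (fd_matrix b N \<epsilon>) \<infinity>) \<and>
    (\<forall>(N, \<epsilon>) \<in> regime \<delta>0. fill_in (fd_matrix b N \<epsilon>) (L N \<epsilon>) =
       (\<Union>k \<in> {1..N - 1}. level_set (fd_matrix b N \<epsilon>) (enat k))) \<and>
    \<comment> \<open>magnitudes\<close>
    (\<forall>k \<ge> 1.
       same_order {(N, \<epsilon>, i, j). (N, \<epsilon>) \<in> regime \<delta>0 \<and> k \<le> N - 1 \<and>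
           (i, j) \<in> level_set (fd_matrix b N \<epsilon>) (enat k)}
         (\<lambda>(N, \<epsilon>, i, j). L N \<epsilon> $$ (i, j)) (\<lambda>(N, \<epsilon>, i, j). \<epsilon>^(2*(k+1)) / (mesh N)^(2*k+1)) \<and>
       same_order {(N, \<epsilon>, i, j). (N, \<epsilon>) \<in> regime \<delta>0 \<and> k \<le> N - 1 \<and>
           (i, j) \<in> level_set (fd_matrix b N \<epsilon>) (enat k)}
         (\<lambda>(N, \<epsilon>, i, j). L N \<epsilon> $$ (i, j)) (\<lambda>(N, \<epsilon>, i, j). (\<epsilon> / mesh N)^(2*(k+1)) * mesh N))"
proof -
  obtain \<delta>1 K0 K where d1: "0 < \<delta>1" and K: "0 < K" and diag_order:
      "\<forall>s\<in>{(N, \<epsilon>, i). (N, \<epsilon>) \<in> regime \<delta>1 \<and> i < (N - 1)\<^sup>2}.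
        K0 * \<bar>(\<lambda>(N, \<epsilon>, i). (mesh N)\<^sup>2) s\<bar> \<le> \<bar>(\<lambda>(N, \<epsilon>, i). fd_matrix b N \<epsilon> $$ (i, i)) s\<bar> \<and>
        \<bar>(\<lambda>(N, \<epsilon>, i). fd_matrix b N \<epsilon> $$ (i, i)) s\<bar> \<le> K * \<bar>(\<lambda>(N, \<epsilon>, i). (mesh N)\<^sup>2) s\<bar>"
    using diagonal unfolding same_order_def by blast
  \<comment> \<open>the first bound makes the upper bound of the diagonal available, the second one ensures \<tau> \<le> 1/2\<close>
  define \<delta>0 where "\<delta>0 = min \<delta>1 (\<bar>\<beta>\<bar> / 3)"
  have beta_pos: "0 < \<bar>\<beta>\<bar>"
    using beta by simp
  have d0: "0 < \<delta>0" "3 * \<delta>0 \<le> \<bar>\<beta>\<bar>"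
    using d1 beta_pos by (simp_all add: \<delta>0_def)
  interpret fd_family b "\<bar>\<beta>\<bar>" \<delta>0 K L
  proof (rule fd_family.intro)
    show "0 < \<bar>\<beta>\<bar>" "3 * \<delta>0 \<le> \<bar>\<beta>\<bar>" "0 < K"
      by (fact beta_pos d0(2) K)+
    fix N \<epsilon> assume r: "(N, \<epsilon>) \<in> regime \<delta>0"
    then have "2 \<le> N" "0 < \<epsilon>"
      by (simp_all add: regime_def)
    then show "fd_cholesky b \<bar>\<beta>\<bar> N \<epsilon> (L N \<epsilon>)"
      using b_lower cholesky beta_pos by unfold_locales (simp_all only: power2_abs)
    have "\<delta>0 * mesh N \<le> \<delta>1 * mesh N"
      by (intro mult_right_mono) (simp_all add: \<delta>0_def mesh_def)
    then have "(N, \<epsilon>) \<in> regime \<delta>1"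
      using r by (simp add: regime_def)
    then show "fd_matrix b N \<epsilon> $$ (i, i) \<le> K * (mesh N)\<^sup>2" if "i < (N - 1)\<^sup>2" for i
      using bspec[OF diag_order, of "(N, \<epsilon>, i)"] that
      by (simp add: abs_le_iff)
  qed
  have rescaled: "(e / h) ^ (2 * (k + 1)) * h = e ^ (2 * (k + 1)) / h ^ (2 * k + 1)"
    for e h :: real and k :: nat
  proof (cases "h = 0")
    case False
    have "h ^ (2 * (k + 1)) = h ^ (2 * k + 1) * h"
      by simp
    then have "(e / h) ^ (2 * (k + 1)) * h = e ^ (2 * (k + 1)) / (h ^ (2 * k + 1) * h) * h"
      by (simp only: power_divide)
    also have "p / (q * h) * h = p / q" for p q
      using False by simp
    finally show ?thesis .
  qed simp
  show ?thesis
  proof (intro exI[of _ \<delta>0] conjI allI impI)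
    show "0 < \<delta>0" by (fact d0(1))
    show "\<forall>(N, \<epsilon>) \<in> regime \<delta>0. \<forall>I < N - 1. \<forall>J < N - 1. I \<noteq> J \<and> I \<noteq> Suc J \<longrightarrow>
       (\<forall>x < N - 1. \<forall>y < N - 1. L N \<epsilon> $$ block_pos (N - 1) I J x y = 0)"
    proof (clarify)
      fix N \<epsilon> I J x y
      assume *: "(N, \<epsilon>) \<in> regime \<delta>0" "I < N - 1" "J < N - 1" "x < N - 1" "y < N - 1" "I \<noteq> J" "I \<noteq> Suc J"
      show "L N \<epsilon> $$ block_pos (N - 1) I J x y = 0"
        using *(6,7) by (intro L_block_eq_0[OF *(1-5)]) (simp only: grid_level_block[OF *(4,5)], simp)
    qed
    show "\<forall>(N, \<epsilon>) \<in> regime \<delta>0. \<forall>x < N - 1. \<forall>y < N - 1. x \<noteq> y \<and> x \<noteq> Suc y \<longrightarrow>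
       L N \<epsilon> $$ block_pos (N - 1) 0 0 x y = 0"
    proof (clarify)
      fix N \<epsilon> x y
      assume *: "(N, \<epsilon>) \<in> regime \<delta>0" "x < N - 1" "y < N - 1" "x \<noteq> y" "x \<noteq> Suc y"
      then have "0 < N - 1" by linarith
      have "x < y \<or> grid_level (N - 1) (0 * (N - 1) + x) (0 * (N - 1) + y) = \<infinity>"
        unfolding grid_level_block[OF *(2,3)] using *(4,5) by (cases "x < y") simp_all
      then show "L N \<epsilon> $$ block_pos (N - 1) 0 0 x y = 0"
        by (intro L_block_eq_0[OF *(1) \<open>0 < N - 1\<close> \<open>0 < N - 1\<close> *(2,3)]) (simp only: simp_thms)
    qed
    show "same_order {(N, \<epsilon>, x). (N, \<epsilon>) \<in> regime \<delta>0 \<and> x < N - 1}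
      (\<lambda>(N, \<epsilon>, x). L N \<epsilon> $$ block_pos (N - 1) 0 0 x x) (\<lambda>(N, \<epsilon>, x). mesh N)"
      by (rule same_order_block_diag, clarify) (metis gr_zeroI less_nat_zero_code)
    show "same_order {(N, \<epsilon>, x). (N, \<epsilon>) \<in> regime \<delta>0 \<and> Suc x < N - 1}
      (\<lambda>(N, \<epsilon>, x). L N \<epsilon> $$ block_pos (N - 1) 0 0 (Suc x) x) (\<lambda>(N, \<epsilon>, x). \<epsilon>^2 / mesh N)"
      by (rule same_order_block_coupling, clarify) (metis gr_zeroI less_nat_zero_code)
    show "\<forall>(N, \<epsilon>) \<in> regime \<delta>0. \<forall>I. Suc I < N - 1 \<longrightarrow> (\<forall>x < N - 1. \<forall>y < x.
       L N \<epsilon> $$ block_pos (N - 1) (Suc I) I x y = 0)"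
    proof (clarify)
      fix N \<epsilon> I x y
      assume *: "(N, \<epsilon>) \<in> regime \<delta>0" "Suc I < N - 1" "x < N - 1" "y < x"
      then have "I < N - 1" and y: "y < N - 1" by linarith+
      then show "L N \<epsilon> $$ block_pos (N - 1) (Suc I) I x y = 0"
        using *(4) by (intro L_block_eq_0[OF *(1,2) _ *(3)]) (simp_all only: grid_level_block[OF *(3) y], simp_all)
    qed
    show "same_order {(N, \<epsilon>, I, x). (N, \<epsilon>) \<in> regime \<delta>0 \<and> Suc I < N - 1 \<and> x < N - 1}
      (\<lambda>(N, \<epsilon>, I, x). L N \<epsilon> $$ block_pos (N - 1) (Suc I) I x x)
      (\<lambda>(N, \<epsilon>, I, x). \<epsilon>^2 / mesh N)"
      by (rule same_order_block_coupling, clarify) metis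
    show "\<forall>(N, \<epsilon>) \<in> regime \<delta>0. \<forall>I. Suc I < N - 1 \<longrightarrow> (\<forall>y < N - 1. \<forall>x < y.
       block_pos (N - 1) (Suc I) I x y \<in> level_set (fd_matrix b N \<epsilon>) (enat (y - x)))"
    proof (clarify)
      fix N \<epsilon> I x y
      assume *: "(N, \<epsilon>) \<in> regime \<delta>0" "Suc I < N - 1" "y < N - 1" "x < y"
      then have x: "x < N - 1" by linarith
      show "block_pos (N - 1) (Suc I) I x y \<in> level_set (fd_matrix b N \<epsilon>) (enat (y - x))"
        using *(4) by (intro block_in_level_set[OF *(1,2) x *(3)]) (simp_all only: grid_level_block[OF x *(3)], simp_all)
    qed
    show "\<forall>(N, \<epsilon>) \<in> regime \<delta>0. \<forall>I < N - 1. 0 < I \<longrightarrow> (\<forall>y < N - 1. \<forall>x < y.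
       L N \<epsilon> $$ block_pos (N - 1) I I x y = 0)"
    proof (clarify)
      fix N \<epsilon> I x y
      assume *: "(N, \<epsilon>) \<in> regime \<delta>0" "I < N - 1" "y < N - 1" "x < y"
      then have "x < N - 1" by linarith
      then show "L N \<epsilon> $$ block_pos (N - 1) I I x y = 0"
        using *(4) by (intro L_block_eq_0[OF *(1,2,2) _ *(3)]) simp_all
    qed
    show "same_order {(N, \<epsilon>, I, x). (N, \<epsilon>) \<in> regime \<delta>0 \<and> 0 < I \<and> I < N - 1 \<and> x < N - 1}
      (\<lambda>(N, \<epsilon>, I, x). L N \<epsilon> $$ block_pos (N - 1) I I x x) (\<lambda>(N, \<epsilon>, I, x). mesh N)"
      by (rule same_order_block_diag, clarify) metis
    show "same_order {(N, \<epsilon>, I, x). (N, \<epsilon>) \<in> regime \<delta>0 \<and> 0 < I \<and> I < N - 1 \<and> Suc x < N - 1}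
      (\<lambda>(N, \<epsilon>, I, x). L N \<epsilon> $$ block_pos (N - 1) I I (Suc x) x)
      (\<lambda>(N, \<epsilon>, I, x). \<epsilon>^2 / mesh N)"
      by (rule same_order_block_coupling, clarify) metis
    show "\<forall>(N, \<epsilon>) \<in> regime \<delta>0. \<forall>I < N - 1. 0 < I \<longrightarrow> (\<forall>x < N - 1. \<forall>y. y + 2 \<le> x \<longrightarrow>
       block_pos (N - 1) I I x y \<in> level_set (fd_matrix b N \<epsilon>) (enat (x - y + 1)))"
    proof (clarify)
      fix N \<epsilon> I x y
      assume *: "(N, \<epsilon>) \<in> regime \<delta>0" "I < N - 1" "x < N - 1" "0 < I" "y + 2 \<le> x"
      then have y: "y < N - 1" by linarith
      show "block_pos (N - 1) I I x y \<in> level_set (fd_matrix b N \<epsilon>) (enat (x - y + 1))"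
        using *(4,5) by (intro block_in_level_set[OF *(1,2,3) y]) (simp_all only: grid_level_block[OF *(3) y], simp_all)
    qed
    show "\<forall>(N, \<epsilon>) \<in> regime \<delta>0. \<forall>i < (N - 1)^2. \<forall>j \<le> i. L N \<epsilon> $$ (i, j) = 0 \<longrightarrow>
       (i, j) \<in> level_set (fd_matrix b N \<epsilon>) \<infinity>"
    proof (clarify)
      fix N \<epsilon> i j
      assume r: "(N, \<epsilon>) \<in> regime \<delta>0" and ij: "i < (N - 1)^2" "j \<le> i" and zero: "L N \<epsilon> $$ (i, j) = 0"
      interpret fd_cholesky b "\<bar>\<beta>\<bar>" N \<epsilon> "L N \<epsilon>"
        by (rule member[OF r])
      show "(i, j) \<in> level_set (fd_matrix b N \<epsilon>) \<infinity>"
        using L_eq_0_iff_level_infinite[OF ij(2,1)] level_eq[OF ij(2,1)] ij zero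
        unfolding level_set_iff by metis
    qed
    show "\<forall>(N, \<epsilon>) \<in> regime \<delta>0. fill_in (fd_matrix b N \<epsilon>) (L N \<epsilon>) =
       (\<Union>k \<in> {1..N - 1}. level_set (fd_matrix b N \<epsilon>) (enat k))"
      using fd_cholesky.fill_in_eq[OF member] by blast
    fix k :: nat assume "1 \<le> k"
    then show "same_order {(N, \<epsilon>, i, j). (N, \<epsilon>) \<in> regime \<delta>0 \<and> k \<le> N - 1 \<and>
           (i, j) \<in> level_set (fd_matrix b N \<epsilon>) (enat k)}
         (\<lambda>(N, \<epsilon>, i, j). L N \<epsilon> $$ (i, j)) (\<lambda>(N, \<epsilon>, i, j). \<epsilon>^(2*(k+1)) / (mesh N)^(2*k+1))"
      by (rule same_order_level_set)
    then show "same_order {(N, \<epsilon>, i, j). (N, \<epsilon>) \<in> regime \<delta>0 \<and> k \<le> N - 1 \<and>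
           (i, j) \<in> level_set (fd_matrix b N \<epsilon>) (enat k)}
         (\<lambda>(N, \<epsilon>, i, j). L N \<epsilon> $$ (i, j)) (\<lambda>(N, \<epsilon>, i, j). (\<epsilon> / mesh N)^(2*(k+1)) * mesh N)"
      unfolding rescaled .
  qed
qed

end
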